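(* Let $m\ge 0$ be an integer, let $\Omega_0\subset\mathbb{R}$ be a closed bounded interval and let $u$ be a function on $\Omega_0$. For a closed subinterval $\Omega=[a,b]\subseteq\Omega_0$ of length $h=b-a$ with $0<h\le 1$, put $\tilde u(t)=u\left(\frac{h}{2}t+\frac{a+b}{2}\right)$, $-1\le t\le 1$, and let $\mathcal{K}^n_{ff}[\tilde u]$ be the $n$-point Fejér first quadrature approximation of $\int_a^b u(y)\,dy$. Let $n_0=1$ if $n$ is odd and $n_0=0$ otherwise. Then the following hold. (i) If $u\in X^m(\Omega_0)$, there is a constant $C>0$, independent of $h$ and $n$, such that for every such $\Omega$ and every integer $n\ge1$, $$\left|\int_a^b u(y)\,dy-\mathcal{K}^n_{ff}[\tilde u]\right|\le C\,\frac{h^{\min\{n+1+n_0,\,m+2\}}}{n^{m+2}}.$$ (ii) If $u\in C^{m+2}(\Omega_0)$, there is a constant $C>0$, independent of $h$ and $n$, such that for every such $\Omega$ and every integer $n\ge1$, $$\left|\int_a^b u(y)\,dy-\mathcal{K}^n_{ff}[\tilde u]\right|\le C\,\frac{h^{\min\{n+1+n_0,\,m+3\}}}{n^{m+2}}.$$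
   Context: For a closed bounded interval $I$ and an integer $m\ge 0$, $X^m(I)=C^m(I)\cap C^{m+2}_{\mathrm{pw}}(I)$: the functions that are $m$ times continuously differentiable on $I$ and have piecewise continuous $(m+2)$-th derivative, i.e. there is a finite partition of $I$ such that on each closed subinterval of the partition the function coincides in the interior with a $C^{m+2}$ function on that closed subinterval. The Fejér first quadrature (FF-Rule) with $n$ points is the interpolatory quadrature on $[-1,1]$ at the nodes $t_i=\cos\left(\pi\frac{2i+1}{2n}\right)$, $0\le i\le n-1$ (the roots of the Chebyshev polynomial $T_n$ of the first kind). Thus $\mathcal{K}^n_{ff}[\tilde u]=\frac h2\int_{-1}^1 L^n[\tilde u](t)\,dt=\frac h2\sum_{i=0}^{n-1}w_i\tilde u(t_i)$, where $L^n[\tilde u]$ is the polynomial of degree at most $n-1$ interpolating $\tilde u$ at $t_0,\dots,t_{n-1}$ and $w_i$ are the corresponding weights. *)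

theory Defs
  imports "HOL-Analysis.Analysis" "HOL-Computational_Algebra.Polynomial"
begin

text \<open>\<open>f\<close> is \<open>k\<close> times continuously differentiable on \<open>S\<close>; \<open>D j\<close> is its \<open>j\<close>-th
  derivative, one-sided at the end points when \<open>S\<close> is a closed interval.\<close>

definition Ck_on :: "nat \<Rightarrow> (real \<Rightarrow> real) \<Rightarrow> real set \<Rightarrow> bool" where
  "Ck_on k f S \<longleftrightarrow>
     (\<exists>D :: nat \<Rightarrow> real \<Rightarrow> real.
        (\<forall>x\<in>S. D 0 x = f x) \<and>
        (\<forall>j<k. \<forall>x\<in>S. (D j has_real_derivative D (Suc j) x) (at x within S)) \<and>
        (\<forall>j\<le>k. continuous_on S (D j)))"

text \<open>The break points are \<open>\<alpha> = p 0 < \<dots> < p N = \<beta>\<close>; the value of \<open>f\<close> at a break point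
  is not constrained.\<close>

definition piecewise_Ck_on :: "nat \<Rightarrow> (real \<Rightarrow> real) \<Rightarrow> real \<Rightarrow> real \<Rightarrow> bool" where
  "piecewise_Ck_on k f \<alpha> \<beta> \<longleftrightarrow>
     (\<exists>(N::nat) (p :: nat \<Rightarrow> real).
        p 0 = \<alpha> \<and> p N = \<beta> \<and> (\<forall>i<N. p i < p (Suc i)) \<and>
        (\<forall>i<N. \<exists>g. Ck_on k g {p i..p (Suc i)} \<and> (\<forall>x\<in>{p i<..<p (Suc i)}. f x = g x)))"

definition X_space :: "nat \<Rightarrow> real \<Rightarrow> real \<Rightarrow> (real \<Rightarrow> real) set" where
  "X_space m \<alpha> \<beta> = {f. Ck_on m f {\<alpha>..\<beta>} \<and> piecewise_Ck_on (m + 2) f \<alpha> \<beta>}"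

definition fejer_node :: "nat \<Rightarrow> nat \<Rightarrow> real" where
  "fejer_node n i = cos (pi * ((2 * real i + 1) / (2 * real n)))"

text \<open>The definite description is meaningful for \<open>n \<ge> 1\<close> only, see
  \<open>fejer_interpolant_ex1\<close> below.\<close>

definition fejer_interpolant :: "nat \<Rightarrow> (real \<Rightarrow> real) \<Rightarrow> real poly" where
  "fejer_interpolant n v =
     (THE p. degree p \<le> n - 1 \<and> (\<forall>i<n. poly p (fejer_node n i) = v (fejer_node n i)))"

definition rescale :: "real \<Rightarrow> real \<Rightarrow> (real \<Rightarrow> real) \<Rightarrow> real \<Rightarrow> real" where
  "rescale a b u t = u ((b - a) / 2 * t + (a + b) / 2)"

text \<open>In \<open>fejer_quadrature h n v\<close>, \<open>v\<close> lives on the reference interval \<open>[-1, 1]\<close> and \<open>h\<close>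
  is the length of the physical interval.\<close>

definition fejer_quadrature :: "real \<Rightarrow> nat \<Rightarrow> (real \<Rightarrow> real) \<Rightarrow> real" where
  "fejer_quadrature h n v = h / 2 * integral {-1..1} (poly (fejer_interpolant n v))"

lemma inj_on_fejer_node: "inj_on (fejer_node n) {..<n}"
proof (rule inj_onI)
  fix i j assume i: "i \<in> {..<n}" and j: "j \<in> {..<n}" and eq: "fejer_node n i = fejer_node n j"
  have n: "real n > 0" using i by auto
  have rng: "0 \<le> pi * ((2 * real k + 1) / (2 * real n)) \<and> pi * ((2 * real k + 1) / (2 * real n)) \<le> pi"
    if "k < n" for k
  proof
    have "(2 * real k + 1) / (2 * real n) \<le> 1" using that n by (simp add: divide_simps)
    then show "pi * ((2 * real k + 1) / (2 * real n)) \<le> pi"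
      by (metis mult.right_neutral mult_left_mono pi_ge_zero)
  qed (use n in auto)
  have "pi * ((2 * real i + 1) / (2 * real n)) = pi * ((2 * real j + 1) / (2 * real n))"
    using cos_inj_pi[of "pi * ((2 * real i + 1) / (2 * real n))" "pi * ((2 * real j + 1) / (2 * real n))"]
      rng i j eq by (auto simp: fejer_node_def)
  then show "i = j" using n by (simp add: field_simps)
qed

lemma fejer_interpolant_ex1:
  assumes n: "n \<ge> 1"
  shows "\<exists>!p. degree p \<le> n - 1 \<and> (\<forall>i<n. poly p (fejer_node n i) = v (fejer_node n i))"
proof (rule ex_ex1I)
  define t where "t = fejer_node n"
  have inj: "inj_on t {..<n}" unfolding t_def by (rule inj_on_fejer_node)
  define l where "l = (\<lambda>i. \<Prod>j\<in>{..<n} - {i}. [:- t j, 1:])"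
  define p where "p = (\<Sum>i<n. smult (v (t i) / poly (l i) (t i)) (l i))"
  have nz: "poly (l i) (t i) \<noteq> 0" if "i < n" for i
    using that inj by (auto simp: l_def poly_prod inj_on_def)
  have z: "poly (l i) (t k) = 0" if "k < n" "i \<noteq> k" for i k
    using that by (auto simp: l_def poly_prod)
  have "degree (l i) \<le> n - 1" if "i < n" for i
  proof -
    have "degree (l i) \<le> (\<Sum>j\<in>{..<n} - {i}. degree [:- t j, 1:])"
      unfolding l_def using degree_prod_sum_le[of "{..<n} - {i}" "\<lambda>j. [:- t j, 1:]"] by (simp add: o_def)
    then show ?thesis using that by simp
  qed
  then have "degree p \<le> n - 1"
    unfolding p_def by (intro degree_sum_le) (auto intro: order.trans[OF degree_smult_le])
  moreover have "poly p (t k) = v (t k)" if k: "k < n" for k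
  proof -
    have "poly p (t k) = (\<Sum>i<n. if i = k then v (t k) else 0)"
      unfolding p_def poly_sum by (intro sum.cong) (use k nz z in auto)
    then show ?thesis using k by simp
  qed
  ultimately show "\<exists>p. degree p \<le> n - 1 \<and> (\<forall>i<n. poly p (fejer_node n i) = v (fejer_node n i))"
    unfolding t_def by blast
next
  fix p q :: "real poly"
  assume p: "degree p \<le> n - 1 \<and> (\<forall>i<n. poly p (fejer_node n i) = v (fejer_node n i))"
    and q: "degree q \<le> n - 1 \<and> (\<forall>i<n. poly q (fejer_node n i) = v (fejer_node n i))"
  show "p = q"
  proof (rule ccontr)
    assume "p \<noteq> q"
    then have ne: "p - q \<noteq> 0" by simp
    have "fejer_node n ` {..<n} \<subseteq> {x. poly (p - q) x = 0}" using p q by auto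
    then have "card (fejer_node n ` {..<n}) \<le> card {x. poly (p - q) x = 0}"
      using poly_roots_finite[OF ne] by (intro card_mono)
    also have "\<dots> \<le> degree (p - q)" using ne by (rule card_poly_roots_bound)
    also have "\<dots> \<le> n - 1" using p q by (intro degree_diff_le) auto
    finally show False using n by (simp add: card_image[OF inj_on_fejer_node])
  qed
qed

end

theory Submission
  imports Defs
begin

text \<open>
  After the substitution \<open>t = cos x\<close> a continuous function on \<open>[-1, 1]\<close> becomes a cosine series, whose
  coefficients \<open>c\<^sub>k\<close> are its Chebyshev coefficients. The error of the Fejer rule is the sum of
  the \<open>c\<^sub>k\<close>, times the errors of the rule for the Chebyshev polynomials \<open>T\<^sub>k\<close>, up to a factor \<open>2/\<pi>\<close>. So two things
  are needed: decay of the coefficients, and control over the errors for the \<open>T\<^sub>k\<close>.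

  \<^item> For the \<open>T\<^sub>k\<close> there is aliasing. At the nodes, \<open>T\<^sub>k\<close> agrees up to its sign with some \<open>T\<^sub>r\<close>, \<open>r \<le> n\<close>;
    the rule is exact for \<open>r < n\<close> and returns 0 for \<open>r = n\<close>. As the integrals of the \<open>T\<^sub>r\<close> are of order \<open>1 / r\<^sup>2\<close>
    and \<open>r\<close> sweeps through its range once while \<open>k\<close> runs through \<open>n\<close> consecutive values, the
    errors over such a block have a sum bounded independently of \<open>n\<close> (\<open>block_error_le\<close>). Hence
    coefficients of order \<open>A / k\<^sup>q\<close> with \<open>q \<ge> 2\<close> lead to an error of order \<open>A / n\<^sup>q\<close>
    (\<open>fejer_error_le_coeff_decay\<close>), without the loss of a power of \<open>n\<close> that summing \<open>A / k\<^sup>q\<close> alone would cost.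

  \<^item> Each integration by parts of \<open>c\<^sub>k\<close> for the function \<open>u\<close> rescaled from an interval of length \<open>h\<close>
    passes to the derivative of \<open>u\<close> and gains a factor of order \<open>h / k\<close> (\<open>cheb_coeff_by_parts\<close>,
    \<open>cheb_coeff_decay\<close>). For \<open>u\<close> in \<open>C\<^sup>m\<^sup>+\<^sup>2\<close> this can be done \<open>m + 2\<close> times. For \<open>u\<close> in \<open>X\<^sup>m\<close> it
    can be done \<open>m + 1\<close> times; the derivative reached then is piecewise \<open>C\<^sup>1\<close>, thus a difference of
    monotone functions, and the second mean value theorem gives one more factor \<open>1 / k\<close>, but no further
    factor \<open>h\<close>. This is the difference between the two exponents of \<open>h\<close>.

  The last factor \<open>h\<close> is the length of the interval. If \<open>n\<close> is small compared to \<open>m\<close>, integration by parts is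
  stopped as soon as the number of derivatives reaches the smallest index of a coefficient that still
  contributes, which is \<open>n\<close> or \<open>n + 1\<close>, whichever is even, because the rule integrates \<open>T\<^sub>n\<close> exactly
  for odd \<open>n\<close>.
\<close>

section \<open>Cosine series of continuous functions\<close>

lemma cos_mult_cos_nat:
  "cos x * cos (real k * x) = (cos (real (k + 1) * x) + cos (real (if k = 0 then 1 else k - 1) * x)) / 2"
proof (cases k)
  case (Suc j)
  have "cos (x * (2 + real j)) = cos (x * (1 + real j) + x)" "cos (x * real j) = cos (x * (1 + real j) - x)"
    by (simp_all add: algebra_simps)
  then show ?thesis using Suc by (simp add: cos_add cos_diff mult_ac add_ac)
qed simp

text \<open>The extra factor \<open>cos (k x)\<close> is carried along because multiplying by \<open>cos x\<close>,
  which raises the degree of the polynomial by one, only replaces \<open>k\<close> by its two neighbours.\<close>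
lemma orthogonal_to_cosines_imp_orthogonal_to_polys:
  assumes d: "continuous_on {0..pi} d"
    and orth: "\<And>k. integral {0..pi} (\<lambda>x. d x * cos (real k * x)) = 0"
  shows "integral {0..pi} (\<lambda>x. d x * poly p (cos x) * cos (real k * x)) = 0"
proof (induction p arbitrary: k)
  case (pCons c p)
  define j where "j = (if k = 0 then 1 else k - 1)"
  have "(\<lambda>x. d x * poly (pCons c p) (cos x) * cos (real k * x)) =
        (\<lambda>x. c * (d x * cos (real k * x)) +
          ((d x * poly p (cos x) * cos (real (k + 1) * x)) / 2 + (d x * poly p (cos x) * cos (real j * x)) / 2))"
    (is "_ = (\<lambda>x. ?A x + (?B x + ?C x))")
  proof
    fix x
    have "d x * poly (pCons c p) (cos x) * cos (real k * x) =
       c * (d x * cos (real k * x)) + d x * poly p (cos x) * (cos x * cos (real k * x))"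
      by (simp add: algebra_simps)
    also have "\<dots> = ?A x + (?B x + ?C x)"
      unfolding cos_mult_cos_nat j_def by (simp add: field_simps)
    finally show "d x * poly (pCons c p) (cos x) * cos (real k * x) = ?A x + (?B x + ?C x)" .
  qed
  moreover have "integral {0..pi} ?A = 0"
    using orth by (subst integral_mult_right) auto
  moreover have "integral {0..pi} ?B = 0"
    using pCons.IH[of "k+1"] by (subst integral_divide) auto
  moreover have "integral {0..pi} ?C = 0"
    using pCons.IH[of j] by (subst integral_divide) auto
  moreover have "?A integrable_on {0..pi}" "?B integrable_on {0..pi}" "?C integrable_on {0..pi}"
    by (intro integrable_continuous_real continuous_intros d continuous_on_poly; simp)+
  ultimately show ?case
    by (simp add: integral_add integrable_add)
qed auto

text \<open>Stone--Weierstrass applies directly to polynomials in \<open>cos x\<close>: they separate the points of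
  \<open>[0, \<pi>]\<close> because the cosine is injective there.\<close>
lemma cosine_polynomials_dense:
  fixes d :: "real \<Rightarrow> real"
  assumes d: "continuous_on {0..pi} d" and e: "e > 0"
  obtains p where "\<And>x. x \<in> {0..pi} \<Longrightarrow> \<bar>d x - poly p (cos x)\<bar> < e"
proof -
  define P where "P f \<longleftrightarrow> (\<exists>p. f = (\<lambda>x. poly p (cos x)))" for f :: "real \<Rightarrow> real"
  have "\<exists>g. P g \<and> (\<forall>x\<in>{0..pi}. \<bar>d x - g x\<bar> < e)"
  proof (rule Stone_Weierstrass_HOL)
    show "P (\<lambda>x. c)" for c
      unfolding P_def by (rule exI[of _ "[:c:]"]) auto
    show "continuous_on {0..pi} f" if "P f" for f
      using that unfolding P_def by (auto intro!: continuous_intros continuous_on_poly)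
    show "P (\<lambda>x. f x + g x)" if fg: "P f \<and> P g" for f g
    proof -
      from fg obtain p q where "f = (\<lambda>x. poly p (cos x))" "g = (\<lambda>x. poly q (cos x))"
        unfolding P_def by blast
      then show ?thesis unfolding P_def by (intro exI[of _ "p + q"]) auto
    qed
    show "P (\<lambda>x. f x * g x)" if fg: "P f \<and> P g" for f g
    proof -
      from fg obtain p q where "f = (\<lambda>x. poly p (cos x))" "g = (\<lambda>x. poly q (cos x))"
        unfolding P_def by blast
      then show ?thesis unfolding P_def by (intro exI[of _ "p * q"]) auto
    qed
    show "\<exists>f. P f \<and> f x \<noteq> f y" if xy: "x \<in> {0..pi} \<and> y \<in> {0..pi} \<and> x \<noteq> y" for x y
    proof (intro exI conjI)
      show "P cos" unfolding P_def by (rule exI[of _ "[:0, 1:]"]) auto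
      show "cos x \<noteq> cos y" using xy cos_inj_pi[of x y] by auto
    qed
  qed (use d e in auto)
  then show ?thesis using that unfolding P_def by blast
qed

text \<open>Completeness of the cosine system. For a polynomial \<open>p\<close> in the cosine that is
  \<open>\<epsilon>\<close>-close to \<open>d\<close>, orthogonality gives \<open>\<integral> d\<^sup>2 = \<integral> d (d - p) \<le> \<epsilon> \<integral> \<bar>d\<bar>\<close>, so \<open>\<integral> d\<^sup>2 = 0\<close>.\<close>
lemma orthogonal_to_cosines_imp_zero:
  assumes d: "continuous_on {0..pi} d"
    and orth: "\<And>k. integral {0..pi} (\<lambda>x. d x * cos (real k * x)) = 0"
    and x: "x \<in> {0..pi}"
  shows "d x = 0"
proof -
  define I where "I = integral {0..pi} (\<lambda>x. d x * d x)"
  define J where "J = integral {0..pi} (\<lambda>x. \<bar>d x\<bar>)"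
  have J: "J \<ge> 0" unfolding J_def by (rule integral_nonneg) (auto intro!: integrable_continuous_real continuous_intros d)
  have le: "I \<le> e * J" if e: "e > 0" for e
  proof -
    obtain p where p: "\<And>x. x \<in> {0..pi} \<Longrightarrow> \<bar>d x - poly p (cos x)\<bar> < e"
      using cosine_polynomials_dense[OF d e] by blast
    have "I = integral {0..pi} (\<lambda>x. d x * d x) - integral {0..pi} (\<lambda>x. d x * poly p (cos x))"
      using orthogonal_to_cosines_imp_orthogonal_to_polys[OF d orth, of p 0] by (simp add: I_def)
    also have "\<dots> = integral {0..pi} (\<lambda>x. d x * d x - d x * poly p (cos x))"
      by (subst integral_diff) (auto intro!: integrable_continuous_real continuous_intros d continuous_on_poly)
    also have "\<dots> \<le> integral {0..pi} (\<lambda>x. e * \<bar>d x\<bar>)"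
    proof (rule integral_le)
      fix x assume "x \<in> {0..pi}"
      have "d x * d x - d x * poly p (cos x) = d x * (d x - poly p (cos x))" by (simp add: algebra_simps)
      also have "\<dots> \<le> \<bar>d x\<bar> * \<bar>d x - poly p (cos x)\<bar>" by (metis abs_ge_self abs_mult)
      also have "\<dots> \<le> \<bar>d x\<bar> * e" using p[OF \<open>x \<in> _\<close>] by (intro mult_left_mono) auto
      finally show "d x * d x - d x * poly p (cos x) \<le> e * \<bar>d x\<bar>" by (simp add: mult.commute)
    qed (auto intro!: integrable_continuous_real continuous_intros d continuous_on_poly)
    also have "\<dots> = e * J" by (simp add: J_def)
    finally show ?thesis .
  qed
  have "I \<le> 0"
  proof (rule field_le_epsilon)
    fix e :: real assume e: "e > 0"
    have "I \<le> e / (J + 1) * J" using le[of "e / (J + 1)"] e J by simp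
    also have "\<dots> \<le> 0 + e" using e J by (simp add: field_simps)
    finally show "I \<le> 0 + e" .
  qed
  moreover have "I \<ge> 0" unfolding I_def
    by (rule integral_nonneg) (auto intro!: integrable_continuous_real continuous_intros d)
  ultimately have "integral {0..pi} (\<lambda>x. d x * d x) = 0" by (simp add: I_def)
  then show ?thesis
    using x by (subst (asm) integral_eq_0_iff) (auto intro!: continuous_intros d)
qed

lemma has_integral_cos_nat:
  "((\<lambda>x. cos (real k * x)) has_integral (if k = 0 then pi else 0)) {0..pi}"
proof (cases "k = 0")
  case True
  then show ?thesis using has_integral_const_real[of "1::real" 0 pi] by simp
next
  case False
  have "((\<lambda>x. cos (real k * x)) has_integral (sin (real k * pi) / real k - sin (real k * 0) / real k)) {0..pi}"
  proof (rule fundamental_theorem_of_calculus)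
    fix x
    show "((\<lambda>x. sin (real k * x) / real k) has_vector_derivative cos (real k * x)) (at x within {0..pi})"
      unfolding has_real_derivative_iff_has_vector_derivative[symmetric]
      using False by (auto intro!: derivative_eq_intros)
  qed simp
  then show ?thesis using False by simp
qed

lemma has_integral_cos_cos:
  "((\<lambda>x. cos (real j * x) * cos (real k * x)) has_integral
     (if j = k then (if k = 0 then pi else pi / 2) else 0)) {0..pi}"
proof -
  define l where "l = (if j \<le> k then k - j else j - k)"
  have "(\<lambda>x. cos (real j * x) * cos (real k * x)) = (\<lambda>x. (cos (real l * x) + cos (real (j + k) * x)) / 2)"
  proof
    fix x
    have "cos (real l * x) = cos (real j * x - real k * x)"
    proof (cases "j \<le> k")
      case True
      then have "real l * x = - (real j * x - real k * x)" by (simp add: l_def of_nat_diff algebra_simps)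
      then show ?thesis by (metis cos_minus)
    next
      case False
      then show ?thesis by (simp add: l_def of_nat_diff algebra_simps)
    qed
    then show "cos (real j * x) * cos (real k * x) = (cos (real l * x) + cos (real (j + k) * x)) / 2"
      by (simp add: cos_times_cos algebra_simps)
  qed
  moreover have "((\<lambda>x. (cos (real l * x) + cos (real (j + k) * x)) / 2) has_integral
     ((if l = 0 then pi else 0) + (if j + k = 0 then pi else 0)) / 2) {0..pi}"
    by (intro has_integral_divide has_integral_add has_integral_cos_nat)
  ultimately show ?thesis by (auto simp: l_def split: if_splits)
qed

text \<open>The Chebyshev coefficient without its usual factor \<open>2/\<pi>\<close> (or \<open>1/\<pi>\<close> for \<open>k = 0\<close>), which would
  only clutter the recurrences; the factor reappears in the partial sums.\<close>
definition cheb_coeff :: "(real \<Rightarrow> real) \<Rightarrow> nat \<Rightarrow> real" where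
  "cheb_coeff f k = integral {0..pi} (\<lambda>x. f (cos x) * cos (real k * x))"

definition cheb_partial_sum :: "(real \<Rightarrow> real) \<Rightarrow> nat \<Rightarrow> real \<Rightarrow> real" where
  "cheb_partial_sum f K x =
     (\<Sum>k<K. (if k = 0 then 1 / pi else 2 / pi) * cheb_coeff f k * cos (real k * x))"

text \<open>Absolute summability makes the cosine series converge uniformly to some continuous function,
  which may be integrated termwise and so has the same coefficients as \<open>f\<close>; completeness then
  identifies the two.\<close>
lemma cheb_partial_sum_uniform_limit:
  assumes f: "continuous_on {-1..1} f" and summ: "summable (\<lambda>k. \<bar>cheb_coeff f k\<bar>)"
  shows "uniform_limit {0..pi} (cheb_partial_sum f) (\<lambda>x. f (cos x)) sequentially"
proof -
  define a where "a k = (if k = 0 then 1 / pi else 2 / pi) * cheb_coeff f k" for k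
  define g where "g x = (\<Sum>k. a k * cos (real k * x))" for x
  have S: "cheb_partial_sum f = (\<lambda>K x. \<Sum>k<K. a k * cos (real k * x))"
    by (simp add: cheb_partial_sum_def a_def fun_eq_iff)
  have lim: "uniform_limit {0..pi} (cheb_partial_sum f) g sequentially"
    unfolding S g_def
  proof (rule Weierstrass_m_test)
    fix k x
    have "\<bar>a k\<bar> \<le> \<bar>cheb_coeff f k\<bar>"
      unfolding a_def abs_mult using pi_gt3 by (intro mult_left_le_one_le) auto
    moreover have "\<bar>a k * cos (real k * x)\<bar> \<le> \<bar>a k\<bar>"
      unfolding abs_mult using abs_cos_le_one by (intro mult_left_le) auto
    ultimately show "norm (a k * cos (real k * x)) \<le> \<bar>cheb_coeff f k\<bar>" by simp
  qed (rule summ)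
  have contS: "continuous_on {0..pi} (cheb_partial_sum f K)" for K
    unfolding S by (intro continuous_intros)
  have contg: "continuous_on {0..pi} g"
    by (rule uniform_limit_theorem[OF _ lim]) (auto simp: contS)
  have cf: "continuous_on {0..pi} (\<lambda>x. f (cos x))"
    by (rule continuous_on_compose2[OF f]) (auto intro!: continuous_intros)
  have same: "integral {0..pi} (\<lambda>x. g x * cos (real k * x)) = cheb_coeff f k" for k
  proof -
    have "bounded ((\<lambda>x. g x) ` {0..pi})"
      using compact_continuous_image[OF contg] by (auto intro: compact_imp_bounded)
    then have "uniform_limit {0..pi} (\<lambda>K x. cheb_partial_sum f K x * cos (real k * x))
        (\<lambda>x. g x * cos (real k * x)) sequentially"
      by (intro bounded_bilinear.bounded_uniform_limit[OF bounded_bilinear_mult] lim uniform_limit_const)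
         (auto intro!: boundedI[of _ 1])
    then obtain I J where I: "\<And>K. ((\<lambda>x. cheb_partial_sum f K x * cos (real k * x)) has_integral I K) {0..pi}"
      and J: "((\<lambda>x. g x * cos (real k * x)) has_integral J) {0..pi}" and IJ: "I \<longlonglongrightarrow> J"
      by (rule uniform_limit_integral) (auto intro!: continuous_intros contS)
    have "I K = cheb_coeff f k" if K: "K > k" for K
    proof -
      have "((\<lambda>x. \<Sum>j<K. a j * (cos (real j * x) * cos (real k * x))) has_integral
         (\<Sum>j<K. a j * (if j = k then (if k = 0 then pi else pi / 2) else 0))) {0..pi}"
        by (intro has_integral_sum has_integral_mult_right has_integral_cos_cos) auto
      also have "(\<Sum>j<K. a j * (if j = k then (if k = 0 then pi else pi / 2) else 0)) =
          (\<Sum>j<K. if j = k then a k * (if k = 0 then pi else pi / 2) else 0)"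
        by (intro sum.cong) auto
      also have "\<dots> = cheb_coeff f k"
        using K by (auto simp: a_def)
      finally have "((\<lambda>x. cheb_partial_sum f K x * cos (real k * x)) has_integral cheb_coeff f k) {0..pi}"
        unfolding S by (simp add: sum_distrib_right mult.assoc)
      with I[of K] show ?thesis by (rule has_integral_unique)
    qed
    then have "\<forall>\<^sub>F K in sequentially. I K = cheb_coeff f k"
      by (rule eventually_mono[OF eventually_gt_at_top[of k]])
    then have "I \<longlonglongrightarrow> cheb_coeff f k" by (rule tendsto_eventually)
    then have "J = cheb_coeff f k" using IJ LIMSEQ_unique by blast
    then show ?thesis using J by auto
  qed
  have "f (cos x) - g x = 0" if "x \<in> {0..pi}" for x
  proof (rule orthogonal_to_cosines_imp_zero[OF _ _ that])
    show "continuous_on {0..pi} (\<lambda>x. f (cos x) - g x)" by (intro continuous_intros cf contg)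
    show "integral {0..pi} (\<lambda>x. (f (cos x) - g x) * cos (real k * x)) = 0" for k
      unfolding left_diff_distrib
      by (subst integral_diff)
         (auto intro!: integrable_continuous_real continuous_intros cf contg simp: same cheb_coeff_def[symmetric])
  qed
  then have "uniform_limit {0..pi} (cheb_partial_sum f) g sequentially \<longleftrightarrow>
      uniform_limit {0..pi} (cheb_partial_sum f) (\<lambda>x. f (cos x)) sequentially"
    by (intro uniform_limit_cong) auto
  with lim show ?thesis by simp
qed

section \<open>Chebyshev polynomials\<close>

fun cheb_poly :: "nat \<Rightarrow> real poly" where
  "cheb_poly 0 = 1"
| "cheb_poly (Suc 0) = [:0, 1:]"
| "cheb_poly (Suc (Suc k)) = [:0, 2:] * cheb_poly (Suc k) - cheb_poly k"

lemma poly_cheb_poly_cos: "poly (cheb_poly k) (cos x) = cos (real k * x)"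
proof (induction k rule: cheb_poly.induct)
  case (3 k)
  then show ?case using cos_mult_cos_nat[of x "Suc k"] by (simp add: algebra_simps)
qed auto

lemma degree_cheb_poly_le: "degree (cheb_poly k) \<le> k"
proof (induction k rule: cheb_poly.induct)
  case (3 k)
  have "degree ([:0, 2:] * cheb_poly (Suc k)) \<le> 1 + Suc k"
    using degree_mult_le[of "[:0, 2:]" "cheb_poly (Suc k)"] 3 by simp
  then show ?case using 3 by (simp add: degree_diff_le del: mult_pCons_left)
qed auto

section \<open>Fejer's rule as a weighted sum\<close>

definition fejer_angle :: "nat \<Rightarrow> nat \<Rightarrow> real" where
  "fejer_angle n i = pi * ((2 * real i + 1) / (2 * real n))"

lemma fejer_node_eq_cos: "fejer_node n i = cos (fejer_angle n i)"
  by (simp add: fejer_node_def fejer_angle_def)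

lemma fejer_angle_bounds:
  assumes "i < n"
  shows "fejer_angle n i \<in> {0..pi}"
proof -
  have "(2 * real i + 1) / (2 * real n) \<le> 1" using assms by (simp add: divide_simps)
  then have "pi * ((2 * real i + 1) / (2 * real n)) \<le> pi"
    by (metis mult.right_neutral mult_left_mono pi_ge_zero)
  then show ?thesis by (simp add: fejer_angle_def)
qed

lemma fejer_interpolantI:
  assumes "n \<ge> 1" "degree p \<le> n - 1" "\<And>i. i < n \<Longrightarrow> poly p (fejer_node n i) = v (fejer_node n i)"
  shows "fejer_interpolant n v = p"
  unfolding fejer_interpolant_def
  by (rule the1_equality[OF fejer_interpolant_ex1]) (use assms in auto)

lemma fejer_interpolant_props:
  assumes "n \<ge> 1"
  shows "degree (fejer_interpolant n v) \<le> n - 1"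
    and "\<And>i. i < n \<Longrightarrow> poly (fejer_interpolant n v) (fejer_node n i) = v (fejer_node n i)"
  using theI'[OF fejer_interpolant_ex1[OF assms, of v]] unfolding fejer_interpolant_def by blast+

text \<open>The integral of the Lagrange basis polynomial of the \<open>i\<close>-th node.\<close>
definition fejer_weight :: "nat \<Rightarrow> nat \<Rightarrow> real" where
  "fejer_weight n i =
     integral {-1..1} (poly (fejer_interpolant n (\<lambda>t. if t = fejer_node n i then 1 else 0)))"

lemma integral_fejer_interpolant:
  assumes n: "n \<ge> 1"
  shows "integral {-1..1} (poly (fejer_interpolant n v)) = (\<Sum>i<n. fejer_weight n i * v (fejer_node n i))"
proof -
  define l where "l i = fejer_interpolant n (\<lambda>t. if t = fejer_node n i then 1 else 0)" for i
  define p where "p = (\<Sum>i<n. smult (v (fejer_node n i)) (l i))"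
  have "fejer_interpolant n v = p"
  proof (rule fejer_interpolantI[OF n])
    show "degree p \<le> n - 1" unfolding p_def l_def
      by (intro degree_sum_le) (auto intro!: order.trans[OF degree_smult_le] fejer_interpolant_props(1)[OF n, simplified])
    fix k assume k: "k < n"
    have "poly p (fejer_node n k) = (\<Sum>i<n. if i = k then v (fejer_node n k) else 0)"
      unfolding p_def poly_sum
    proof (intro sum.cong refl)
      fix i assume i: "i \<in> {..<n}"
      then show "poly (smult (v (fejer_node n i)) (l i)) (fejer_node n k) =
          (if i = k then v (fejer_node n k) else 0)"
        using inj_on_fejer_node[of n] k unfolding l_def
        by (auto simp: fejer_interpolant_props(2)[OF n] inj_on_def)
    qed
    then show "poly p (fejer_node n k) = v (fejer_node n k)" using k by simp
  qed
  then have "poly (fejer_interpolant n v) = (\<lambda>t. \<Sum>i<n. v (fejer_node n i) * poly (l i) t)"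
    by (intro ext) (simp add: p_def poly_sum)
  then have "integral {-1..1} (poly (fejer_interpolant n v)) =
      integral {-1..1} (\<lambda>t. \<Sum>i<n. v (fejer_node n i) * poly (l i) t)"
    by simp
  also have "\<dots> = (\<Sum>i<n. integral {-1..1} (\<lambda>t. v (fejer_node n i) * poly (l i) t))"
    by (intro integral_sum) (auto intro!: integrable_continuous_real continuous_intros continuous_on_poly)
  also have "\<dots> = (\<Sum>i<n. v (fejer_node n i) * integral {-1..1} (poly (l i)))"
    by simp
  finally show ?thesis unfolding fejer_weight_def l_def[symmetric] by (simp only: mult.commute)
qed

section \<open>Integrals of Chebyshev polynomials and their aliases\<close>

lemma has_integral_cos_substitution:
  fixes f :: "real \<Rightarrow> real"
  assumes f: "continuous_on {-1..1} f"
  shows "((\<lambda>x. f (cos x) * sin x) has_integral integral {-1..1} f) {0..pi}"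
proof -
  define F where "F t = integral {-1..t} f" for t
  have dF: "(F has_real_derivative f t) (at t within {-1..1})" if "t \<in> {-1..1}" for t
    unfolding F_def by (rule integral_has_real_derivative[OF f that])
  then have contF: "continuous_on {-1..1} F"
    by (rule DERIV_continuous_on)
  have "((\<lambda>x. f (cos x) * sin x) has_integral ((- F (cos pi)) - (- F (cos 0)))) {0..pi}"
  proof (rule fundamental_theorem_of_calculus_interior)
    show "continuous_on {0..pi} (\<lambda>x. - F (cos x))"
      by (intro continuous_intros continuous_on_compose2[OF contF]) auto
    fix x assume x: "x \<in> {0<..<pi}"
    have c: "-1 < cos x" "cos x < 1"
      using x cos_monotone_0_pi[of 0 x] cos_monotone_0_pi[of x pi] by simp_all
    then have "at (cos x) within {-1..1} = at (cos x)"
      by (intro at_within_interior) simp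
    then have "(F has_real_derivative f (cos x)) (at (cos x))"
      using dF[of "cos x"] c by auto
    from DERIV_minus[OF DERIV_chain2[OF this DERIV_cos]]
    have "((\<lambda>x. - F (cos x)) has_real_derivative f (cos x) * sin x) (at x)"
      by simp
    then show "((\<lambda>x. - F (cos x)) has_vector_derivative f (cos x) * sin x) (at x)"
      by (simp add: has_real_derivative_iff_has_vector_derivative)
  qed simp
  then show ?thesis by (simp add: F_def)
qed

definition cheb_integral :: "nat \<Rightarrow> real" where
  "cheb_integral k = integral {0..pi} (\<lambda>x. cos (real k * x) * sin x)"

lemma integral_cheb_poly: "integral {-1..1} (poly (cheb_poly k)) = cheb_integral k"
  using integral_unique[OF has_integral_cos_substitution[of "poly (cheb_poly k)"]]
  by (simp add: poly_cheb_poly_cos cheb_integral_def continuous_on_poly)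

lemma cheb_integral_0: "cheb_integral 0 = 2"
  using integral_cheb_poly[of 0] by (simp add: poly_1[abs_def])

lemma cheb_integral_1: "cheb_integral (Suc 0) = 0"
proof -
  have "((\<lambda>x. cos x * sin x) has_integral ((sin pi)\<^sup>2 / 2 - (sin 0)\<^sup>2 / 2)) {0..pi::real}"
    by (rule fundamental_theorem_of_calculus)
       (auto simp: has_real_derivative_iff_has_vector_derivative[symmetric] intro!: derivative_eq_intros)
  then show ?thesis by (simp add: cheb_integral_def integral_unique)
qed

lemma cheb_integral_ge2:
  assumes k: "k \<ge> 2"
  shows "cheb_integral k = - (1 + (-1) ^ k) / ((real k + 1) * (real k - 1))"
proof -
  obtain j where j: "k = Suc j" using k by (cases k) auto
  have jpos: "real j > 0" using k j by simp
  define F where "F x = - (cos (real (k + 1) * x) / real (k + 1) - cos (real j * x) / real j) / 2" for x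
  have "((\<lambda>x. cos (real k * x) * sin x) has_integral (F pi - F 0)) {0..pi}"
  proof (rule fundamental_theorem_of_calculus)
    fix x
    have "(F has_real_derivative (sin (real (k + 1) * x) - sin (real j * x)) / 2) (at x within {0..pi})"
    proof -
      have "real (k + 1) \<noteq> 0" by simp
      with jpos show ?thesis unfolding F_def
        by (auto intro!: derivative_eq_intros simp: diff_divide_distrib simp del: of_nat_Suc of_nat_add)
    qed
    moreover have "(sin (real (k + 1) * x) - sin (real j * x)) / 2 = cos (real k * x) * sin x"
    proof -
      have "real (k + 1) * x = real k * x + x" "real j * x = real k * x - x"
        by (auto simp: j algebra_simps)
      then show ?thesis by (simp add: sin_add sin_diff)
    qed
    ultimately show "(F has_vector_derivative cos (real k * x) * sin x) (at x within {0..pi})"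
      by (simp add: has_real_derivative_iff_has_vector_derivative)
  qed simp
  then have "cheb_integral k = F pi - F 0"
    by (simp add: cheb_integral_def integral_unique)
  also have "\<dots> = - (1 + (-1) ^ k) / ((real k + 1) * (real k - 1))"
    using jpos by (auto simp: F_def j cos_npi divide_simps simp del: of_nat_Suc) (auto simp: algebra_simps)
  finally show ?thesis .
qed

lemma cheb_integral_odd: "odd k \<Longrightarrow> cheb_integral k = 0"
  using cheb_integral_1 cheb_integral_ge2[of k] by (cases "k = 1") (auto elim!: oddE)

text \<open>A decreasing majorant of \<open>\<bar>cheb_integral k\<bar>\<close> whose series telescopes. That its sum is finite
  makes the total error over a block of frequencies bounded independently of \<open>n\<close>.\<close>
definition cheb_integral_bound :: "nat \<Rightarrow> real" where
  "cheb_integral_bound k = (if k \<le> 1 then 2 else 2 / (real k * (real k - 1)))"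

lemma abs_cheb_integral_le: "\<bar>cheb_integral k\<bar> \<le> cheb_integral_bound k"
proof (cases "k \<le> 1")
  case True
  then show ?thesis using cheb_integral_0 cheb_integral_1
    by (cases k) (auto simp: cheb_integral_bound_def)
next
  case False
  then have k: "real k \<ge> 2" by simp
  have "\<bar>cheb_integral k\<bar> = \<bar>1 + (-1) ^ k\<bar> / ((real k + 1) * (real k - 1))"
    using False k by (simp add: cheb_integral_ge2 abs_mult)
  also have "\<dots> \<le> 2 / (real k * (real k - 1))"
    using k by (intro frac_le mult_right_mono) (auto simp: minus_one_power_iff)
  finally show ?thesis using False by (simp add: cheb_integral_bound_def)
qed

lemma cheb_integral_bound_antimono:
  assumes "j \<le> k"
  shows "cheb_integral_bound k \<le> cheb_integral_bound j"
proof (cases "k \<le> 1")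
  case False
  then have k: "real k \<ge> 2" by simp
  show ?thesis
  proof (cases "j \<le> 1")
    case True
    have "1 \<le> real k * (real k - 1)" using k mult_mono[of 1 "real k" 1 "real k - 1"] by simp
    then show ?thesis using True False by (simp add: cheb_integral_bound_def divide_simps)
  next
    case False
    then have "real j * (real j - 1) \<le> real k * (real k - 1)" "0 < real j * (real j - 1)"
      using assms by (auto intro!: mult_mono)
    then show ?thesis using False assms by (simp add: cheb_integral_bound_def frac_le)
  qed
qed (use assms in \<open>auto simp: cheb_integral_bound_def\<close>)

lemma cheb_integral_bound_nonneg: "cheb_integral_bound k \<ge> 0"
  using abs_cheb_integral_le[of k] by linarith

lemma sum_cheb_integral_bound_le: "(\<Sum>k<K. cheb_integral_bound k) \<le> 6"
proof -
  have "(\<Sum>k<K + 2. cheb_integral_bound k) \<le> 6 - 2 / (real K + 1)"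
  proof (induction K)
    case (Suc K)
    have "cheb_integral_bound (K + 2) = 2 / (real K + 1) - 2 / (real (Suc K) + 1)"
      by (simp add: cheb_integral_bound_def field_simps)
    then show ?case using Suc by simp
  qed (simp add: cheb_integral_bound_def numeral_2_eq_2)
  moreover have "(\<Sum>k<K. cheb_integral_bound k) \<le> (\<Sum>k<K + 2. cheb_integral_bound k)"
    by (intro sum_mono2) (auto simp: cheb_integral_bound_nonneg)
  moreover have "2 / (real K + 1) \<ge> 0" by simp
  ultimately show ?thesis by linarith
qed

text \<open>The Fejer rule applied to the \<open>k\<close>-th Chebyshev polynomial, see \<open>poly_cheb_poly_cos\<close>.\<close>
definition fejer_cheb :: "nat \<Rightarrow> nat \<Rightarrow> real" where
  "fejer_cheb n k = (\<Sum>i<n. fejer_weight n i * cos (real k * fejer_angle n i))"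

lemma fejer_cheb_exact:
  assumes "n \<ge> 1" "k < n"
  shows "fejer_cheb n k = cheb_integral k"
proof -
  have "fejer_interpolant n (poly (cheb_poly k)) = cheb_poly k"
    using assms degree_cheb_poly_le[of k] by (intro fejer_interpolantI) auto
  then show ?thesis
    using integral_fejer_interpolant[OF assms(1), of "poly (cheb_poly k)"]
    by (simp add: fejer_cheb_def integral_cheb_poly fejer_node_eq_cos poly_cheb_poly_cos)
qed

text \<open>The nodes are the zeros of the \<open>n\<close>-th Chebyshev polynomial. Together with
  \<open>cheb_integral_odd\<close> this is the extra degree of exactness for odd \<open>n\<close>.\<close>
lemma fejer_cheb_n: "n \<ge> 1 \<Longrightarrow> fejer_cheb n n = 0"
proof -
  assume "n \<ge> 1"
  have "cos (real n * fejer_angle n i) = 0" for i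
  proof -
    have "real n * fejer_angle n i = real i * pi + pi / 2"
      using \<open>n \<ge> 1\<close> by (simp add: fejer_angle_def field_simps)
    then show ?thesis by (simp add: cos_add)
  qed
  then show ?thesis by (simp add: fejer_cheb_def)
qed

text \<open>Aliasing: as \<open>2 n \<theta>\<^sub>i\<close> is an odd multiple of \<open>\<pi>\<close>, shifting the frequency by \<open>2 n l\<close> or
  reflecting it changes the values at the nodes by a common sign only. The sign \<open>e\<close> covers both
  shifted and reflected frequencies.\<close>
lemma cos_alias:
  assumes "n \<ge> 1" "real k = 2 * real n * real l + e * real r" "e = 1 \<or> e = -1"
  shows "cos (real k * fejer_angle n i) = (-1) ^ l * cos (real r * fejer_angle n i)"
proof -
  have "real k * fejer_angle n i = real (l * (2 * i + 1)) * pi + e * (real r * fejer_angle n i)"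
    using assms(1) unfolding assms(2) by (simp add: fejer_angle_def field_simps)
  moreover have "(-1 :: real) ^ (l * (2 * i + 1)) = (-1) ^ l"
    by (simp add: minus_one_power_iff)
  ultimately show ?thesis
    using assms(3) cos_npi[of "l * (2 * i + 1)"] sin_npi[of "l * (2 * i + 1)"]
    by (auto simp: cos_add cos_diff simp del: of_nat_mult of_nat_add)
qed

lemma fejer_cheb_alias:
  assumes "n \<ge> 1" "real k = 2 * real n * real l + e * real r" "e = 1 \<or> e = -1"
  shows "fejer_cheb n k = (-1) ^ l * fejer_cheb n r"
  unfolding fejer_cheb_def sum_distrib_left by (intro sum.cong refl) (simp add: cos_alias[OF assms])

text \<open>Within a block of \<open>n\<close> consecutive frequencies, the alias runs once through \<open>0, \<dots>, n - 1\<close>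
  upwards (\<open>j\<close> even) or through \<open>n, \<dots>, 1\<close> downwards (\<open>j\<close> odd). The rule is exact on an alias below \<open>n\<close>
  and vanishes on the alias \<open>n\<close>. For odd \<open>j\<close> the alias is \<open>n - s\<close>; the bound is weakened to \<open>n - s - 1\<close>
  so that it, too, ranges over \<open>0, \<dots>, n - 1\<close>.\<close>
lemma abs_fejer_cheb_le:
  assumes n: "n \<ge> 1" and s: "s < n"
  shows "\<bar>fejer_cheb n (j * n + s)\<bar> \<le> cheb_integral_bound (if even j then s else n - Suc s)"
proof (cases "even j")
  case True
  then obtain l where j: "j = 2 * l" by (auto elim: evenE)
  have "fejer_cheb n (j * n + s) = (-1) ^ l * fejer_cheb n s"
    by (rule fejer_cheb_alias[OF n, where e = 1]) (auto simp: j)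
  then show ?thesis using True abs_cheb_integral_le[of s] s
    by (simp add: fejer_cheb_exact[OF n] abs_mult)
next
  case False
  then obtain l where j: "j = 2 * l + 1" by (auto elim: oddE)
  define r where "r = n - s"
  have "fejer_cheb n (j * n + s) = (-1) ^ (l + 1) * fejer_cheb n r"
    by (rule fejer_cheb_alias[OF n, where e = "-1"]) (use s in \<open>auto simp: j r_def of_nat_diff algebra_simps\<close>)
  moreover have "\<bar>fejer_cheb n r\<bar> \<le> cheb_integral_bound r"
  proof (cases "s = 0")
    case True
    then show ?thesis by (simp add: r_def fejer_cheb_n[OF n] cheb_integral_bound_nonneg)
  next
    case False
    then show ?thesis using s abs_cheb_integral_le[of r]
      by (simp add: fejer_cheb_exact[OF n] r_def)
  qed
  moreover have "cheb_integral_bound r \<le> cheb_integral_bound (n - Suc s)"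
    by (rule cheb_integral_bound_antimono) (simp add: r_def)
  ultimately show ?thesis using False by (simp add: abs_mult)
qed

text \<open>Uniform in \<open>n\<close> and \<open>j\<close>: the exact integrals and the aliased ones each contribute at most the
  full sum of \<open>cheb_integral_bound\<close>, which is at most 6.\<close>
lemma block_error_le:
  assumes n: "n \<ge> 1"
  shows "(\<Sum>k = j * n..<j * n + n. \<bar>cheb_integral k - fejer_cheb n k\<bar>) \<le> 12"
proof -
  have "(\<Sum>k = j * n..<j * n + n. \<bar>cheb_integral k - fejer_cheb n k\<bar>) =
      (\<Sum>s<n. \<bar>cheb_integral (j * n + s) - fejer_cheb n (j * n + s)\<bar>)"
    using sum.shift_bounds_nat_ivl[of "\<lambda>k. \<bar>cheb_integral k - fejer_cheb n k\<bar>" 0 "j * n" n]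
    by (simp add: lessThan_atLeast0 add.commute)
  also have "\<dots> \<le> (\<Sum>s<n. cheb_integral_bound s + cheb_integral_bound (if even j then s else n - Suc s))"
  proof (rule sum_mono)
    fix s assume s: "s \<in> {..<n}"
    show "\<bar>cheb_integral (j * n + s) - fejer_cheb n (j * n + s)\<bar> \<le>
        cheb_integral_bound s + cheb_integral_bound (if even j then s else n - Suc s)"
      using s abs_fejer_cheb_le[OF n, of s j] abs_cheb_integral_le[of "j * n + s"]
        cheb_integral_bound_antimono[of s "j * n + s"] by auto
  qed
  also have "\<dots> = (\<Sum>s<n. cheb_integral_bound s) + (\<Sum>s<n. cheb_integral_bound (if even j then s else n - Suc s))"
    by (rule sum.distrib)
  also have "(\<Sum>s<n. cheb_integral_bound (if even j then s else n - Suc s)) = (\<Sum>s<n. cheb_integral_bound s)"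
    by (cases "even j") (simp_all add: sum.nat_diff_reindex)
  finally show ?thesis using sum_cheb_integral_bound_le[of n] by linarith
qed

section \<open>From coefficient decay to the quadrature error\<close>

text \<open>Apply the error functional to the Chebyshev series termwise. Terms up to the degree of exactness
  drop out. On the block of frequencies \<open>j n \<le> k < (j + 1) n\<close> the coefficients are at most
  \<open>A / (j n)\<^sup>q\<close> while the errors of the Chebyshev polynomials add up to at most 12, so the total
  is at most \<open>12 A / n\<^sup>q \<sqdot> \<Sum>\<^sub>j 1 / j\<^sup>q\<close>, and the last sum is at most 2. The hypothesis on the coefficients
  starts at the degree of exactness plus one, which for odd \<open>n\<close> is \<open>n + 1\<close>.\<close>

lemma fejer_error_le_coeff_decay:
  fixes f :: "real \<Rightarrow> real"
  assumes n: "n \<ge> 1" and f: "continuous_on {-1..1} f" and q: "q \<ge> 2" and A: "A \<ge> 0"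
    and dec: "\<And>k. k \<ge> n + (if odd n then 1 else 0) \<Longrightarrow> \<bar>cheb_coeff f k\<bar> \<le> A / real k ^ q"
  shows "\<bar>integral {-1..1} f - integral {-1..1} (poly (fejer_interpolant n f))\<bar> \<le> 24 * A / real n ^ q"
proof -
  define N where "N = n + (if odd n then 1 else 0)"
  define a where "a k = (if k = 0 then 1 / pi else 2 / pi) * cheb_coeff f k" for k
  define err where "err k = cheb_integral k - fejer_cheb n k" for k
  define L where "L K = (\<Sum>k<K. a k * err k)" for K
  have a_le: "\<bar>a k\<bar> \<le> \<bar>cheb_coeff f k\<bar>" for k
    unfolding a_def abs_mult using pi_gt3 by (intro mult_left_le_one_le) auto
  have err0: "err k = 0" if "k < N" for k
  proof (cases "k < n")
    case True
    then show ?thesis by (simp add: err_def fejer_cheb_exact[OF n])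
  next
    case False
    then have "k = n" "odd n" using that by (auto simp: N_def split: if_splits)
    then show ?thesis by (simp add: err_def fejer_cheb_n[OF n] cheb_integral_odd)
  qed
  have "summable (\<lambda>k. \<bar>cheb_coeff f k\<bar>)"
  proof (rule summable_comparison_test_ev)
    show "summable (\<lambda>k. A * inverse (real k ^ q))"
      by (intro summable_mult inverse_power_summable q)
    show "\<forall>\<^sub>F k in sequentially. norm \<bar>cheb_coeff f k\<bar> \<le> A * inverse (real k ^ q)"
      using dec by (intro eventually_sequentiallyI[of N]) (auto simp: N_def divide_inverse)
  qed
  then have lim: "uniform_limit {0..pi} (cheb_partial_sum f) (\<lambda>x. f (cos x)) sequentially"
    by (rule cheb_partial_sum_uniform_limit[OF f])
  have S: "cheb_partial_sum f K x = (\<Sum>k<K. a k * cos (real k * x))" for K x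
    by (simp add: cheb_partial_sum_def a_def)
  have "uniform_limit {0..pi} (\<lambda>K x. cheb_partial_sum f K x * sin x) (\<lambda>x. f (cos x) * sin x) sequentially"
  proof (intro bounded_bilinear.bounded_uniform_limit[OF bounded_bilinear_mult] lim uniform_limit_const)
    show "bounded ((\<lambda>x. f (cos x)) ` {0..pi})"
      by (intro compact_imp_bounded compact_continuous_image continuous_on_compose2[OF f])
         (auto intro!: continuous_intros)
  qed (auto intro!: boundedI[of _ 1])
  then obtain I J where I: "\<And>K. ((\<lambda>x. cheb_partial_sum f K x * sin x) has_integral I K) {0..pi}"
    and J: "((\<lambda>x. f (cos x) * sin x) has_integral J) {0..pi}" and IJ: "I \<longlonglongrightarrow> J"
    by (rule uniform_limit_integral) (auto intro!: continuous_intros simp: S)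
  have J': "J = integral {-1..1} f"
    using has_integral_unique[OF J has_integral_cos_substitution[OF f]] .
  have I': "I K = (\<Sum>k<K. a k * cheb_integral k)" for K
  proof -
    have "((\<lambda>x. \<Sum>k<K. a k * (cos (real k * x) * sin x)) has_integral (\<Sum>k<K. a k * cheb_integral k)) {0..pi}"
      unfolding cheb_integral_def
      by (intro has_integral_sum has_integral_mult_right integrable_integral
           integrable_continuous_real continuous_intros) auto
    then have "((\<lambda>x. cheb_partial_sum f K x * sin x) has_integral (\<Sum>k<K. a k * cheb_integral k)) {0..pi}"
      by (simp add: S sum_distrib_right mult.assoc)
    with I show ?thesis by (rule has_integral_unique)
  qed
  have L_eq: "L K = I K - (\<Sum>i<n. fejer_weight n i * cheb_partial_sum f K (fejer_angle n i))" for K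
  proof -
    have "(\<Sum>i<n. fejer_weight n i * cheb_partial_sum f K (fejer_angle n i)) = (\<Sum>k<K. a k * fejer_cheb n k)"
      unfolding S fejer_cheb_def sum_distrib_left
      by (subst sum.swap) (simp add: mult_ac)
    then show ?thesis by (simp add: L_def I' err_def right_diff_distrib sum_subtractf)
  qed
  define E where "E = integral {-1..1} f - integral {-1..1} (poly (fejer_interpolant n f))"
  \<comment> \<open>Only the values at finitely many nodes and the integral enter,
    so the error of the partial sums converges to the error of \<open>f\<close>.\<close>
  have "(\<lambda>K. I K - (\<Sum>i<n. fejer_weight n i * cheb_partial_sum f K (fejer_angle n i)))
     \<longlonglongrightarrow> J - (\<Sum>i<n. fejer_weight n i * f (cos (fejer_angle n i)))"
    by (intro tendsto_intros IJ tendsto_uniform_limitI[OF lim] fejer_angle_bounds) auto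
  then have "L \<longlonglongrightarrow> E"
    by (simp add: L_eq[abs_def] E_def J' integral_fejer_interpolant[OF n] fejer_node_eq_cos)
  \<comment> \<open>Cutting the series at multiples of \<open>n\<close> leaves complete blocks.\<close>
  moreover have "strict_mono (\<lambda>M. M * n)" using n by (auto simp: strict_mono_def)
  ultimately have "(\<lambda>M. L (M * n)) \<longlonglongrightarrow> E"
    using LIMSEQ_subseq_LIMSEQ[of L E "\<lambda>M. M * n"] by (simp add: o_def)
  then have "(\<lambda>M. \<bar>L (M * n)\<bar>) \<longlonglongrightarrow> \<bar>E\<bar>" by (rule tendsto_rabs)
  moreover have "\<bar>L (M * n)\<bar> \<le> 24 * A / real n ^ q" for M
  proof -
    define B where "B j = 12 * A / real n ^ q * (1 / real j ^ 2)" for j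
    have block: "(\<Sum>k = j * n..<j * n + n. \<bar>a k * err k\<bar>) \<le> B j" for j
    proof (cases "j = 0")
      case True
      then show ?thesis by (simp add: err0 N_def B_def)
    next
      case False
      then have jn: "0 < j * n" using n by simp
      have le: "\<bar>a k * err k\<bar> \<le> A / real (j * n) ^ q * \<bar>err k\<bar>" if k: "j * n \<le> k" for k
      proof (cases "k < N")
        case False
        have "\<bar>a k\<bar> \<le> A / real k ^ q" using a_le[of k] dec[of k] False by (simp add: N_def)
        also have "\<dots> \<le> A / real (j * n) ^ q"
          using k A jn less_le_trans[OF jn k] by (intro divide_left_mono power_mono mult_pos_pos zero_less_power) (simp_all del: of_nat_mult)
        finally show ?thesis unfolding abs_mult by (rule mult_right_mono) simp
      qed (simp add: err0)
      have "(\<Sum>k = j * n..<j * n + n. \<bar>a k * err k\<bar>) \<le>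
          (\<Sum>k = j * n..<j * n + n. A / real (j * n) ^ q * \<bar>err k\<bar>)"
        by (intro sum_mono le) auto
      also have "\<dots> = A / real (j * n) ^ q * (\<Sum>k = j * n..<j * n + n. \<bar>err k\<bar>)"
        by (simp add: sum_distrib_left)
      also have "\<dots> \<le> A / real (j * n) ^ q * 12"
        using block_error_le[OF n, of j] A unfolding err_def by (intro mult_left_mono) auto
      also have "\<dots> = 12 * A / real n ^ q * (1 / real j ^ q)"
        by (simp add: power_mult_distrib mult_ac)
      also have "\<dots> \<le> B j"
        unfolding B_def using False A q
        by (intro mult_left_mono divide_left_mono power_increasing) auto
      finally show ?thesis .
    qed
    have sq: "(\<Sum>j<M. 1 / real j ^ 2) \<le> 2"
    proof -
      have "(\<Sum>j<M + 2. 1 / real j ^ 2) \<le> 2 - 1 / (real M + 1)"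
      proof (induction M)
        case (Suc M)
        have "1 / real (M + 2) ^ 2 \<le> 1 / ((real M + 1) * (real M + 2))"
          by (intro divide_left_mono) (auto simp: power2_eq_square intro!: mult_mono mult_pos_pos)
        also have "\<dots> = 1 / (real M + 1) - 1 / (real (Suc M) + 1)" by (simp add: field_simps)
        finally show ?case using Suc by simp
      qed (simp add: numeral_2_eq_2)
      moreover have "(\<Sum>j<M. 1 / real j ^ 2) \<le> (\<Sum>j<M + 2. 1 / real j ^ 2)"
        by (intro sum_mono2) auto
      moreover have "1 / (real M + 1) \<ge> 0" by simp
      ultimately show ?thesis by linarith
    qed
    have "\<bar>L (M * n)\<bar> \<le> (\<Sum>k<M * n. \<bar>a k * err k\<bar>)" unfolding L_def by (rule sum_abs)
    also have "\<dots> = (\<Sum>j<M. \<Sum>k = j * n..<j * n + n. \<bar>a k * err k\<bar>)"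
      by (rule sum.nat_group[symmetric])
    also have "\<dots> \<le> (\<Sum>j<M. B j)" by (intro sum_mono block)
    also have "\<dots> = 12 * A / real n ^ q * (\<Sum>j<M. 1 / real j ^ 2)"
      by (simp add: B_def sum_distrib_left)
    also have "\<dots> \<le> 12 * A / real n ^ q * 2" using A by (intro mult_left_mono sq) auto
    finally show ?thesis by simp
  qed
  ultimately show ?thesis unfolding E_def[symmetric] by (intro LIMSEQ_le_const2) auto
qed

section \<open>Decay of the Chebyshev coefficients\<close>

lemma rescale_cos_mem:
  fixes a b :: real
  assumes "a < b"
  shows "(b - a) / 2 * cos x + (a + b) / 2 \<in> {a..b}"
proof -
  have "(b - a) / 2 * cos x \<le> (b - a) / 2 * 1"
    using assms by (intro mult_left_mono) auto
  moreover have "(b - a) / 2 * (-1) \<le> (b - a) / 2 * cos x"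
    using assms by (intro mult_left_mono) auto
  ultimately show ?thesis by (auto simp: field_simps)
qed

lemma continuous_on_rescale_cos:
  assumes "a < b" "continuous_on {a..b} v"
  shows "continuous_on T (\<lambda>x. rescale a b v (cos x))"
  unfolding rescale_def
  by (rule continuous_on_compose2[OF assms(2)]) (use rescale_cos_mem[OF assms(1)] in \<open>auto intro!: continuous_intros\<close>)

text \<open>Integration by parts gains a factor \<open>(b - a) / k\<close> per derivative: the factor \<open>(b - a) / 2\<close> comes from
  the rescaling, and \<open>sin x\<close> from differentiating \<open>cos x\<close> turns \<open>sin (k x)\<close> back into cosines of the
  neighbouring frequencies. The boundary terms vanish because \<open>sin (k x)\<close> does at \<open>0\<close> and \<open>\<pi>\<close>. The
  finite set \<open>S\<close> of exceptional points admits piecewise differentiable \<open>v\<close>.\<close>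
lemma cheb_coeff_by_parts:
  fixes v v' :: "real \<Rightarrow> real"
  assumes ab: "a < b" and S: "finite S" and v: "continuous_on {a..b} v"
    and der: "\<And>x. x \<in> {a<..<b} - S \<Longrightarrow> (v has_real_derivative v' x) (at x)"
    and int: "\<And>k. (\<lambda>x. rescale a b v' (cos x) * cos (real k * x)) integrable_on {0..pi}"
    and k: "k \<ge> 1"
  shows "cheb_coeff (rescale a b v) k = (b - a) / (4 * real k) *
           (cheb_coeff (rescale a b v') (k - 1) - cheb_coeff (rescale a b v') (k + 1))"
proof -
  define w where "w x = (b - a) / 2 * cos x + (a + b) / 2" for x
  define S' where "S' = w -` S \<inter> {0..pi}"
  have "inj_on w {0..pi}"
    using ab cos_inj_pi by (auto simp: w_def inj_on_def)
  then have S': "finite S'" unfolding S'_def by (intro finite_vimage_IntI S)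
  define H where "H x = v (w x) * sin (real k * x) / real k" for x
  \<comment> \<open>The derivative of \<open>H\<close>, already written with cosines only.\<close>
  define H' where "H' x = v (w x) * cos (real k * x) -
     (b - a) / (4 * real k) * (v' (w x) * cos (real (k - 1) * x) - v' (w x) * cos (real (k + 1) * x))" for x
  have "(H' has_integral (H pi - H 0)) {0..pi}"
  proof (rule fundamental_theorem_of_calculus_interior_strong[OF S'])
    have "continuous_on {0..pi} (\<lambda>x. v (w x))"
      using continuous_on_rescale_cos[OF ab v] by (simp add: rescale_def w_def)
    then show "continuous_on {0..pi} H" unfolding H_def
      using k by (intro continuous_intros) auto
    fix x assume x: "x \<in> {0<..<pi} - S'"
    have "cos x \<in> {-1<..<1}"
      using x cos_monotone_0_pi[of 0 x] cos_monotone_0_pi[of x pi] by auto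
    then have "(b - a) / 2 * cos x < (b - a) / 2 * 1"
      using ab by (intro mult_strict_left_mono) auto
    moreover have "(b - a) / 2 * (-1) < (b - a) / 2 * cos x"
      using ab \<open>cos x \<in> _\<close> by (intro mult_strict_left_mono) auto
    ultimately have "w x \<in> {a<..<b}" by (auto simp: w_def field_simps)
    moreover have "w x \<notin> S" using x by (auto simp: S'_def)
    ultimately have dv: "(v has_real_derivative v' (w x)) (at (w x))" by (intro der) auto
    have dw: "(w has_real_derivative - ((b - a) / 2 * sin x)) (at x)"
      unfolding w_def by (auto intro!: derivative_eq_intros)
    have "(H has_real_derivative v' (w x) * - ((b - a) / 2 * sin x) * sin (real k * x) / real k
        + v (w x) * cos (real k * x)) (at x)"
      unfolding H_def using k by (auto intro!: derivative_eq_intros DERIV_chain2[OF dv dw] simp: field_simps)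
    moreover have cc: "cos (real (k - 1) * x) - cos (real (k + 1) * x) = 2 * (sin x * sin (real k * x))"
    proof -
      have "real (k + 1) * x = real k * x + x" "real (k - 1) * x = real k * x - x"
        using k by (auto simp: of_nat_diff algebra_simps)
      then show ?thesis by (simp add: cos_add cos_diff)
    qed
    have "v' (w x) * - ((b - a) / 2 * sin x) * sin (real k * x) / real k + v (w x) * cos (real k * x) = H' x"
      unfolding H'_def right_diff_distrib[symmetric] cc using k by (simp add: divide_simps)
    ultimately show "(H has_vector_derivative H' x) (at x)"
      by (simp add: has_real_derivative_iff_has_vector_derivative)
  qed simp
  then have "(H' has_integral 0) {0..pi}" by (simp add: H_def)
  moreover have "((\<lambda>x. (b - a) / (4 * real k) * (v' (w x) * cos (real (k - 1) * x) - v' (w x) * cos (real (k + 1) * x)))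
     has_integral (b - a) / (4 * real k) *
           (cheb_coeff (rescale a b v') (k - 1) - cheb_coeff (rescale a b v') (k + 1))) {0..pi}"
    unfolding cheb_coeff_def
    by (intro has_integral_mult_right has_integral_diff has_integral_eq_rhs[OF integrable_integral])
       (use int[of "k - 1"] int[of "k + 1"] in \<open>simp_all add: rescale_def w_def\<close>)
  ultimately have "((\<lambda>x. v (w x) * cos (real k * x)) has_integral 0 + (b - a) / (4 * real k) *
           (cheb_coeff (rescale a b v') (k - 1) - cheb_coeff (rescale a b v') (k + 1))) {0..pi}"
    by (rule has_integral_eq[rotated, OF has_integral_add]) (simp add: H'_def)
  then show ?thesis by (simp add: cheb_coeff_def rescale_def w_def integral_unique)
qed

lemma falling_prod_pos:
  assumes "k \<ge> q"
  shows "(\<Prod>j<q. real k - real j) > 0"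
  using assms by (intro prod_pos) auto

text \<open>Iterates \<open>cheb_coeff_by_parts\<close>. The falling product (rather than a power of \<open>k\<close>) makes the induction
  exact, since the frequency may drop by one in each step. The parameter \<open>e\<close> is the order of decay
  that the coefficients of the last function \<open>D i\<close> already have by themselves.\<close>
lemma cheb_coeff_decay:
  fixes D :: "nat \<Rightarrow> real \<Rightarrow> real"
  assumes ab: "a < b" and S: "finite S" and A: "A \<ge> 0"
    and cont: "\<And>j. j < i \<Longrightarrow> continuous_on {a..b} (D j)"
    and der: "\<And>j x. j < i \<Longrightarrow> x \<in> {a<..<b} - S \<Longrightarrow> (D j has_real_derivative D (Suc j) x) (at x)"
    and int: "\<And>k. (\<lambda>x. rescale a b (D i) (cos x) * cos (real k * x)) integrable_on {0..pi}"
    and base: "\<And>k. k \<ge> e \<Longrightarrow> \<bar>cheb_coeff (rescale a b (D i)) k\<bar> \<le> A / (\<Prod>j<e. real k - real j)"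
    and k: "k \<ge> i + e"
  shows "\<bar>cheb_coeff (rescale a b (D 0)) k\<bar> \<le> ((b - a) / 2) ^ i * A / (\<Prod>j<i + e. real k - real j)"
  using cont der int base k
proof (induction i arbitrary: D k)
  case 0
  then show ?case by simp
next
  case (Suc i)
  define P where "P k = (\<Prod>j<i + e. real k - real j)" for k :: nat
  define X where "X = ((b - a) / 2) ^ i * A"
  have X: "X \<ge> 0" using ab A by (simp add: X_def)
  have IH: "\<bar>cheb_coeff (rescale a b (D 1)) l\<bar> \<le> X / P l" if "l \<ge> i + e" for l
    using Suc.IH[of "\<lambda>j. D (Suc j)" l] Suc.prems that by (simp add: X_def P_def)
  have int1: "(\<lambda>x. rescale a b (D 1) (cos x) * cos (real k * x)) integrable_on {0..pi}" for k
  proof (cases "i = 0")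
    case True
    then show ?thesis using Suc.prems(3)[of k] by simp
  next
    case False
    then show ?thesis using Suc.prems(1)[of 1]
      by (intro integrable_continuous_real continuous_intros continuous_on_rescale_cos ab) auto
  qed
  have k: "k \<ge> 1" "k - 1 \<ge> i + e" using Suc.prems(5) by auto
  have Pp: "P (k - 1) > 0" unfolding P_def by (rule falling_prod_pos) (use k in auto)
  have Pm: "P (k - 1) \<le> P (k + 1)" unfolding P_def
    using k by (intro prod_mono) (auto simp: of_nat_diff)
  have "cheb_coeff (rescale a b (D 0)) k = (b - a) / (4 * real k) *
      (cheb_coeff (rescale a b (D 1)) (k - 1) - cheb_coeff (rescale a b (D 1)) (k + 1))"
    by (rule cheb_coeff_by_parts[OF ab S _ _ int1 k(1)]) (use Suc.prems(1,2)[of 0] in auto)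
  \<comment> \<open>Of the two neighbours, \<open>k - 1\<close> has the weaker bound.\<close>
  also have "\<bar>\<dots>\<bar> \<le> (b - a) / (4 * real k) * (2 * (X / P (k - 1)))"
  proof -
    have "X / P (k + 1) \<le> X / P (k - 1)"
      using X Pp Pm by (intro divide_left_mono) auto
    then have "\<bar>cheb_coeff (rescale a b (D 1)) (k - 1) - cheb_coeff (rescale a b (D 1)) (k + 1)\<bar> \<le> 2 * (X / P (k - 1))"
      using IH[OF k(2)] IH[of "k + 1"] k by linarith
    then show ?thesis unfolding abs_mult using ab k by (intro mult_mono) auto
  qed
  also have "\<dots> = (b - a) / 2 * X / (real k * P (k - 1))"
    using k Pp by (simp add: divide_simps)
  also have "real k * P (k - 1) = (\<Prod>j<Suc i + e. real k - real j)"
    using k unfolding P_def add_Suc prod.lessThan_Suc_shift by (simp add: of_nat_diff algebra_simps)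
  finally show ?case by (simp add: X_def)
qed

lemma power_le_falling_prod:
  assumes "k \<ge> q"
  shows "real k ^ q \<le> real q ^ q * (\<Prod>j<q. real k - real j)"
proof -
  have "real k \<le> real q * (real k - real j)" if "j < q" for j
  proof -
    \<comment> \<open>The smallest factor is \<open>k - q + 1\<close>, and \<open>q (k - q + 1) - k = (q - 1) (k - q)\<close>.\<close>
    have "0 \<le> (real q - 1) * (real k - real q)" using that assms by (intro mult_nonneg_nonneg) auto
    also have "\<dots> = real q * (real k - real (q - 1)) - real k" using that by (simp add: of_nat_diff algebra_simps)
    also have "\<dots> \<le> real q * (real k - real j) - real k" using that by (intro diff_right_mono mult_left_mono) auto
    finally show ?thesis by simp
  qed
  then have "(\<Prod>j<q. real k) \<le> (\<Prod>j<q. real q * (real k - real j))"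
    by (intro prod_mono) auto
  then show ?thesis by (simp add: prod.distrib)
qed

lemma cheb_coeff_power_decay:
  fixes D :: "nat \<Rightarrow> real \<Rightarrow> real"
  assumes ab: "a < b" and S: "finite S" and A: "A \<ge> 0"
    and cont: "\<And>j. j < i \<Longrightarrow> continuous_on {a..b} (D j)"
    and der: "\<And>j x. j < i \<Longrightarrow> x \<in> {a<..<b} - S \<Longrightarrow> (D j has_real_derivative D (Suc j) x) (at x)"
    and int: "\<And>k. (\<lambda>x. rescale a b (D i) (cos x) * cos (real k * x)) integrable_on {0..pi}"
    and base: "\<And>k. k \<ge> e \<Longrightarrow> \<bar>cheb_coeff (rescale a b (D i)) k\<bar> \<le> A / (\<Prod>j<e. real k - real j)"
    and k: "k \<ge> i + e" "k \<ge> 1"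
  shows "\<bar>cheb_coeff (rescale a b (D 0)) k\<bar> \<le> (b - a) ^ i * (A * real (i + e) ^ (i + e)) / real k ^ (i + e)"
proof -
  define P where "P = (\<Prod>j<i + e. real k - real j)"
  have P: "P > 0" unfolding P_def by (rule falling_prod_pos[OF k(1)])
  have "\<bar>cheb_coeff (rescale a b (D 0)) k\<bar> \<le> ((b - a) / 2) ^ i * A / P"
    unfolding P_def by (rule cheb_coeff_decay[where S = S]) (use assms in auto)
  also have "\<dots> \<le> (b - a) ^ i * A / P"
    using ab A P by (intro divide_right_mono mult_right_mono power_mono) auto
  also have "\<dots> \<le> (b - a) ^ i * A * (real (i + e) ^ (i + e) / real k ^ (i + e))"
  proof -
    have "1 / P \<le> real (i + e) ^ (i + e) / real k ^ (i + e)"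
      using power_le_falling_prod[OF k(1)] k(2) P by (simp add: P_def divide_simps mult.commute)
    then have "(b - a) ^ i * A * (1 / P) \<le> (b - a) ^ i * A * (real (i + e) ^ (i + e) / real k ^ (i + e))"
      using ab A by (intro mult_left_mono) auto
    then show ?thesis by simp
  qed
  finally show ?thesis by (simp add: mult_ac)
qed

lemma abs_integral_cos_le:
  assumes "k \<ge> 1" "c \<le> d"
  shows "\<bar>integral {c..d} (\<lambda>x. cos (real k * x))\<bar> \<le> 2 / real k"
proof -
  have "((\<lambda>x. cos (real k * x)) has_integral (sin (real k * d) / real k - sin (real k * c) / real k)) {c..d}"
    using assms
    by (intro fundamental_theorem_of_calculus)
       (auto simp: has_real_derivative_iff_has_vector_derivative[symmetric] intro!: derivative_eq_intros)
  then have "integral {c..d} (\<lambda>x. cos (real k * x)) = (sin (real k * d) - sin (real k * c)) / real k"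
    by (simp add: integral_unique diff_divide_distrib)
  moreover have "\<bar>sin (real k * d) - sin (real k * c)\<bar> \<le> 2"
    using abs_sin_le_one[of "real k * d"] abs_sin_le_one[of "real k * c"] by linarith
  ultimately show ?thesis by (simp add: abs_divide divide_right_mono)
qed

text \<open>A monotone function has coefficients of order \<open>1 / k\<close> by the second mean value theorem, which also
  provides integrability.\<close>
lemma cheb_coeff_mono:
  fixes P :: "real \<Rightarrow> real"
  assumes ab: "a < b" and P: "mono_on {a..b} P"
  shows "(\<lambda>x. rescale a b P (cos x) * cos (real k * x)) integrable_on {0..pi}"
    and "k \<ge> 1 \<Longrightarrow> \<bar>cheb_coeff (rescale a b P) k\<bar> \<le> 2 * (\<bar>P a\<bar> + \<bar>P b\<bar>) / real k"
proof -
  define g where "g x = - rescale a b P (cos x)" for x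
  have g: "g x \<le> g y" if "0 \<le> x" "x \<le> y" "y \<le> pi" for x y
  proof -
    have "cos y \<le> cos x" using that cos_mono_le_eq[of y x] by auto
    then have "(b - a) / 2 * cos y \<le> (b - a) / 2 * cos x" using ab by (intro mult_left_mono) auto
    then show ?thesis
      unfolding g_def rescale_def using rescale_cos_mem[OF ab] by (intro le_imp_neg_le mono_onD[OF P]) auto
  qed
  have "(\<lambda>x. cos (real k * x)) integrable_on {0..pi}" by (intro integrable_continuous_real continuous_intros)
  from second_mean_value_theorem_full[where g = g, OF this pi_ge_zero g]
  obtain c where c: "c \<in> {0..pi}" and
     I: "((\<lambda>x. g x * cos (real k * x)) has_integral
          (g 0 * integral {0..c} (\<lambda>x. cos (real k * x)) + g pi * integral {c..pi} (\<lambda>x. cos (real k * x)))) {0..pi}"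
    by blast
  from has_integral_neg[OF I] have I':
    "((\<lambda>x. rescale a b P (cos x) * cos (real k * x)) has_integral
          - (g 0 * integral {0..c} (\<lambda>x. cos (real k * x)) + g pi * integral {c..pi} (\<lambda>x. cos (real k * x)))) {0..pi}"
    by (simp add: g_def)
  then show "(\<lambda>x. rescale a b P (cos x) * cos (real k * x)) integrable_on {0..pi}" by blast
  assume k: "k \<ge> 1"
  have "g 0 = - P b" "g pi = - P a" by (simp_all add: g_def rescale_def field_simps)
  then have "\<bar>cheb_coeff (rescale a b P) k\<bar> =
     \<bar>P b * integral {0..c} (\<lambda>x. cos (real k * x)) + P a * integral {c..pi} (\<lambda>x. cos (real k * x))\<bar>"
    using I' by (simp add: cheb_coeff_def integral_unique)
  also have "\<dots> \<le> \<bar>P b\<bar> * \<bar>integral {0..c} (\<lambda>x. cos (real k * x))\<bar> + \<bar>P a\<bar> * \<bar>integral {c..pi} (\<lambda>x. cos (real k * x))\<bar>"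
    by (metis abs_mult abs_triangle_ineq)
  also have "\<dots> \<le> \<bar>P b\<bar> * (2 / real k) + \<bar>P a\<bar> * (2 / real k)"
    using c by (intro add_mono mult_left_mono abs_integral_cos_le k) auto
  finally show "\<bar>cheb_coeff (rescale a b P) k\<bar> \<le> 2 * (\<bar>P a\<bar> + \<bar>P b\<bar>) / real k"
    by (simp add: add_divide_distrib algebra_simps)
qed

lemma cheb_coeff_bounded:
  assumes int: "(\<lambda>x. v (cos x) * cos (real k * x)) integrable_on {0..pi}"
    and B: "\<And>t. t \<in> {-1..1} \<Longrightarrow> \<bar>v t\<bar> \<le> B"
  shows "\<bar>cheb_coeff v k\<bar> \<le> pi * B"
proof -
  have "norm (integral {0..pi} (\<lambda>x. v (cos x) * cos (real k * x))) \<le> integral {0..pi} (\<lambda>x::real. B)"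
  proof (rule integral_norm_bound_integral[OF int])
    fix x :: real
    have "\<bar>v (cos x)\<bar> * \<bar>cos (real k * x)\<bar> \<le> B * 1"
      using B[of "cos x"] by (intro mult_mono) auto
    then show "norm (v (cos x) * cos (real k * x)) \<le> B" by (simp add: abs_mult)
  qed auto
  then show ?thesis by (simp add: cheb_coeff_def)
qed

section \<open>Piecewise smooth functions\<close>

text \<open>Appends one piece of a piecewise function to a decomposition into monotone functions. On the new
  piece, adding a linear function makes \<open>V\<close> increasing; constants of the size of the bound \<open>B\<close> lift both
  parts over possible jumps of \<open>V\<close> at the end points of the piece.\<close>

lemma monotone_difference_extend:
  fixes V :: "real \<Rightarrow> real"
  assumes P: "mono_on {a..c} P" and Q: "mono_on {a..c} Q" and PQ: "\<And>x. x \<in> {a..c} \<Longrightarrow> V x = P x - Q x"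
    and ac: "a \<le> c" and L: "L \<ge> 0"
    and mono: "mono_on {c<..<d} (\<lambda>x. V x + L * x)"
    and B: "\<And>x. x \<in> {c<..d} \<Longrightarrow> \<bar>V x\<bar> \<le> B" and cd: "c < d"
  obtains P' Q' where "mono_on {a..d} P'" "mono_on {a..d} Q'" "\<And>x. x \<in> {a..d} \<Longrightarrow> V x = P' x - Q' x"
proof -
  define K where "K = max (P c) (Q c) + B"
  define R where "R x = K + L * (x - c) + (if x < d then 0 else 2 * B)" for x
  define P' where "P' x = (if x \<le> c then P x else V x + R x)" for x
  define Q' where "Q' x = (if x \<le> c then Q x else R x)" for x
  have B0: "B \<ge> 0" using B[of d] cd by auto
  have R: "R x \<le> R y" if "x \<le> y" for x y
    using that B0 mult_left_mono[OF diff_right_mono[OF that, of c] L] by (auto simp: R_def)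
  have RK: "K \<le> R x" if "c < x" for x using that L B0 by (auto simp: R_def)
  have "mono_on {a..d} P'"
  proof (rule mono_onI)
    fix x y assume x: "x \<in> {a..d}" and y: "y \<in> {a..d}" and xy: "x \<le> y"
    consider "y \<le> c" | "x \<le> c" "c < y" | "c < x" "y < d" | "c < x" "x < d" "y = d" | "x = y"
      using x y xy by force
    then show "P' x \<le> P' y"
    proof cases
      case 1
      then show ?thesis using x y xy by (auto simp: P'_def intro!: mono_onD[OF P])
    next
      case 2
      have "P x \<le> P c" using 2 x ac by (intro mono_onD[OF P]) auto
      also have "\<dots> \<le> V y + R y" using RK[of y] B[of y] 2 y by (auto simp: K_def)
      finally show ?thesis using 2 by (simp add: P'_def)
    next
      case 3
      have "V x + L * x \<le> V y + L * y"
        using mono_onD[OF mono, of x y] 3 xy by auto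
      then show ?thesis using 3 xy by (simp add: P'_def R_def algebra_simps)
    next
      case 4
      have "L * x \<le> L * d" using L 4 by (intro mult_left_mono) auto
      then show ?thesis using 4 cd B[of x] B[of d] by (simp add: P'_def R_def algebra_simps)
    qed simp
  qed
  moreover have "mono_on {a..d} Q'"
  proof (rule mono_onI)
    fix x y assume x: "x \<in> {a..d}" and y: "y \<in> {a..d}" and xy: "x \<le> y"
    consider "y \<le> c" | "x \<le> c" "c < y" | "c < x" using x y xy by force
    then show "Q' x \<le> Q' y"
    proof cases
      case 1
      then show ?thesis using x y xy by (auto simp: Q'_def intro!: mono_onD[OF Q])
    next
      case 2
      have "Q x \<le> Q c" using 2 x ac by (intro mono_onD[OF Q]) auto
      also have "\<dots> \<le> R y" using RK[of y] B0 2 by (auto simp: K_def)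
      finally show ?thesis using 2 by (simp add: Q'_def)
    next
      case 3
      then show ?thesis using R[OF xy] xy by (simp add: Q'_def)
    qed
  qed
  moreover have "V x = P' x - Q' x" if "x \<in> {a..d}" for x
    using that PQ by (simp add: P'_def Q'_def)
  ultimately show ?thesis using that by blast
qed

lemma partition_mono:
  fixes p :: "nat \<Rightarrow> real"
  assumes "\<And>i. i < N \<Longrightarrow> p i < p (Suc i)" "i \<le> j" "j \<le> N"
  shows "p i \<le> p j"
  using assms(2,3)
proof (induction j rule: dec_induct)
  case (step j)
  then show ?case using assms(1)[of j] by simp
qed simp

text \<open>Being a difference of monotone functions stands in for bounded variation, and is exactly what the
  second mean value theorem needs. The values of \<open>V\<close> at the break points are arbitrary.\<close>
lemma piecewise_C1_monotone_difference:
  fixes V :: "real \<Rightarrow> real" and p :: "nat \<Rightarrow> real"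
  assumes p: "\<And>i. i < N \<Longrightarrow> p i < p (Suc i)"
    and piece: "\<And>i. i < N \<Longrightarrow> \<exists>g g'. (\<forall>x\<in>{p i<..<p (Suc i)}. V x = g x) \<and>
       continuous_on {p i..p (Suc i)} g \<and> continuous_on {p i..p (Suc i)} g' \<and>
       (\<forall>x\<in>{p i<..<p (Suc i)}. (g has_real_derivative g' x) (at x))"
  shows "\<exists>P Q. mono_on {p 0..p N} P \<and> mono_on {p 0..p N} Q \<and> (\<forall>x\<in>{p 0..p N}. V x = P x - Q x)"
  using p piece
proof (induction N)
  case 0
  show ?case
    by (rule exI[of _ V], rule exI[of _ "\<lambda>_. 0"]) (auto simp: mono_on_def)
next
  case (Suc N)
  then obtain P Q where PQ: "mono_on {p 0..p N} P" "mono_on {p 0..p N} Q"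
      "\<And>x. x \<in> {p 0..p N} \<Longrightarrow> V x = P x - Q x"
    by (metis less_Suc_eq)
  define c d where "c = p N" and "d = p (Suc N)"
  have cd: "c < d" using Suc.prems(1)[of N] by (simp add: c_def d_def)
  have p0: "p 0 \<le> c" unfolding c_def by (rule partition_mono[of N]) (use Suc.prems(1) in auto)
  from Suc.prems(2)[of N] obtain g g' where g: "\<And>x. x \<in> {c<..<d} \<Longrightarrow> V x = g x"
      "continuous_on {c..d} g" "continuous_on {c..d} g'"
      "\<And>x. x \<in> {c<..<d} \<Longrightarrow> (g has_real_derivative g' x) (at x)"
    unfolding c_def d_def by blast
  have "bounded (g ` {c..d})" "bounded (g' ` {c..d})"
    using g by (auto intro!: compact_imp_bounded compact_continuous_image)
  then obtain B0 L where "\<forall>y\<in>g ` {c..d}. norm y \<le> B0" "\<forall>y\<in>g' ` {c..d}. norm y \<le> L"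
    unfolding bounded_iff by blast
  then have B0: "\<bar>g x\<bar> \<le> B0" and L: "\<bar>g' x\<bar> \<le> L" if "x \<in> {c..d}" for x
    using that by auto
  have L0: "L \<ge> 0" using L[of c] cd by auto
  \<comment> \<open>\<open>B0\<close> says nothing about \<open>V d\<close>, as \<open>V\<close> and \<open>g\<close> may differ at the break point \<open>d\<close>.\<close>
  define B where "B = max B0 \<bar>V d\<bar>"
  have monoV: "mono_on {c<..<d} (\<lambda>x. V x + L * x)"
  proof (rule mono_onI)
    fix x y assume xy: "x \<in> {c<..<d}" "y \<in> {c<..<d}" "x \<le> y"
    have "g x + L * x \<le> g y + L * y"
    proof (rule DERIV_nonneg_imp_nondecreasing[OF xy(3)])
      fix t assume t: "x \<le> t" "t \<le> y"
      then have "((\<lambda>x. g x + L * x) has_real_derivative g' t + L) (at t)"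
        using xy by (auto intro!: derivative_eq_intros g(4))
      moreover have "g' t + L \<ge> 0" using L[of t] xy t by auto
      ultimately show "\<exists>z. ((\<lambda>x. g x + L * x) has_real_derivative z) (at t) \<and> 0 \<le> z" by blast
    qed
    then show "V x + L * x \<le> V y + L * y" using g(1) xy by simp
  qed
  have VB: "\<bar>V x\<bar> \<le> B" if "x \<in> {c<..d}" for x
    using that B0[of x] g(1)[of x] by (cases "x = d") (auto simp: B_def)
  obtain P' Q' where "mono_on {p 0..d} P'" "mono_on {p 0..d} Q'"
      "\<And>x. x \<in> {p 0..d} \<Longrightarrow> V x = P' x - Q' x"
    by (rule monotone_difference_extend[where V = V and B = B,
          OF PQ[folded c_def] p0 L0 monoV VB cd]) blast+
  then show ?case unfolding d_def by (intro exI[of _ P'] exI[of _ Q']) simp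
qed

lemma partition_cover:
  fixes p :: "nat \<Rightarrow> real"
  assumes "x \<in> {p 0..p N}" "x \<notin> p ` {..N}"
  shows "\<exists>i<N. x \<in> {p i<..<p (Suc i)}"
  using assms
proof (induction N)
  case (Suc N)
  show ?case
  proof (cases "x \<le> p N")
    case True
    then have "\<exists>i<N. x \<in> {p i<..<p (Suc i)}" using Suc.prems by (intro Suc.IH) auto
    then show ?thesis using less_SucI by blast
  next
    case False
    moreover have "x \<noteq> p (Suc N)" using Suc.prems(2) by auto
    ultimately show ?thesis using Suc.prems(1) by (intro exI[of _ N]) auto
  qed
qed auto

lemma derivatives_agree_on_open:
  fixes D G :: "nat \<Rightarrow> real \<Rightarrow> real"
  assumes T: "open T" and 0: "\<And>x. x \<in> T \<Longrightarrow> D 0 x = G 0 x"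
    and D: "\<And>j x. j < m \<Longrightarrow> x \<in> T \<Longrightarrow> (D j has_real_derivative D (Suc j) x) (at x)"
    and G: "\<And>j x. j < m \<Longrightarrow> x \<in> T \<Longrightarrow> (G j has_real_derivative G (Suc j) x) (at x)"
    and j: "j \<le> m" and x: "x \<in> T"
  shows "D j x = G j x"
  using j x
proof (induction j arbitrary: x)
  case (Suc j)
  have "(D j has_real_derivative G (Suc j) x) (at x)"
    using has_field_derivative_transform_within_open[OF G[of j x] T Suc.prems(2), of "D j"] Suc by simp
  then show ?case using D[of j x] Suc.prems by (metis DERIV_unique Suc_le_lessD)
qed (simp add: 0)

text \<open>Two-sided derivatives in the interior are all that integration by parts needs.\<close>
lemma Ck_onE:
  assumes "Ck_on k f {\<alpha>..\<beta>}"
  obtains D where "\<And>x. x \<in> {\<alpha>..\<beta>} \<Longrightarrow> D 0 x = f x"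
    "\<And>j. j \<le> k \<Longrightarrow> continuous_on {\<alpha>..\<beta>} (D j)"
    "\<And>j x. j < k \<Longrightarrow> x \<in> {\<alpha><..<\<beta>} \<Longrightarrow> (D j has_real_derivative D (Suc j) x) (at x)"
proof -
  from assms obtain D where D: "\<forall>x\<in>{\<alpha>..\<beta>}. D 0 x = f x"
    "\<forall>j<k. \<forall>x\<in>{\<alpha>..\<beta>}. (D j has_real_derivative D (Suc j) x) (at x within {\<alpha>..\<beta>})"
    "\<forall>j\<le>k. continuous_on {\<alpha>..\<beta>} (D j)"
    unfolding Ck_on_def by blast
  have "(D j has_real_derivative D (Suc j) x) (at x)" if "j < k" "x \<in> {\<alpha><..<\<beta>}" for j x
  proof -
    have "at x within {\<alpha>..\<beta>} = at x" using that by (intro at_within_interior) auto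
    then show ?thesis using D(2) that by (metis atLeastAtMost_iff greaterThanLessThan_iff less_imp_le)
  qed
  with D show ?thesis using that by blast
qed

text \<open>Elements of \<open>X\<^sup>m\<close> carry one derivative more than their global smoothness: on each piece, the
  derivatives up to order \<open>m\<close> coincide with those of the smooth extension, so off the break points the
  \<open>m\<close>-th derivative has itself a derivative, which is piecewise \<open>C\<^sup>1\<close> and hence a difference of
  monotone functions.\<close>
lemma X_spaceE:
  assumes "u \<in> X_space m \<alpha> \<beta>"
  obtains D S P Q where "finite S" "\<And>x. x \<in> {\<alpha>..\<beta>} \<Longrightarrow> D 0 x = u x"
    "\<And>j. j \<le> m \<Longrightarrow> continuous_on {\<alpha>..\<beta>} (D j)"
    "\<And>j x. j \<le> m \<Longrightarrow> x \<in> {\<alpha><..<\<beta>} - S \<Longrightarrow> (D j has_real_derivative D (Suc j) x) (at x)"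
    "mono_on {\<alpha>..\<beta>} P" "mono_on {\<alpha>..\<beta>} Q" "\<And>x. x \<in> {\<alpha>..\<beta>} \<Longrightarrow> D (Suc m) x = P x - Q x"
proof -
  from assms have C: "Ck_on m u {\<alpha>..\<beta>}" and pw: "piecewise_Ck_on (m + 2) u \<alpha> \<beta>"
    by (auto simp: X_space_def)
  obtain D0 where D0: "\<And>x. x \<in> {\<alpha>..\<beta>} \<Longrightarrow> D0 0 x = u x"
    "\<And>j. j \<le> m \<Longrightarrow> continuous_on {\<alpha>..\<beta>} (D0 j)"
    "\<And>j x. j < m \<Longrightarrow> x \<in> {\<alpha><..<\<beta>} \<Longrightarrow> (D0 j has_real_derivative D0 (Suc j) x) (at x)"
    by (rule Ck_onE[OF C]) blast
  from pw obtain N p where p: "p 0 = \<alpha>" "p N = \<beta>" "\<And>i. i < N \<Longrightarrow> p i < p (Suc i)"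
    and pieces: "\<And>i. i < N \<Longrightarrow> \<exists>g. Ck_on (m + 2) g {p i..p (Suc i)} \<and> (\<forall>x\<in>{p i<..<p (Suc i)}. u x = g x)"
    unfolding piecewise_Ck_on_def by blast
  define S where "S = p ` {..N}"
  \<comment> \<open>The value 0 at the break points is a placeholder.\<close>
  define V where "V x = (if x \<in> S then 0 else deriv (D0 m) x)" for x
  define D where "D = D0(Suc m := V)"
  have piece: "\<exists>G. (\<forall>x\<in>{p i<..<p (Suc i)}. V x = G (Suc m) x \<and> (D0 m has_real_derivative V x) (at x)) \<and>
      continuous_on {p i..p (Suc i)} (G (Suc m)) \<and> continuous_on {p i..p (Suc i)} (G (Suc (Suc m))) \<and>
      (\<forall>x\<in>{p i<..<p (Suc i)}. (G (Suc m) has_real_derivative G (Suc (Suc m)) x) (at x))"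
    if i: "i < N" for i
  proof -
    define T where "T = {p i<..<p (Suc i)}"
    have sub: "T \<subseteq> {\<alpha><..<\<beta>}"
      using partition_mono[of N p, OF p(3), of 0 i] partition_mono[of N p, OF p(3), of "Suc i" N] i p
      by (auto simp: T_def)
    have TS: "x \<notin> S" if "x \<in> T" for x
    proof
      assume "x \<in> S"
      then obtain j where j: "j \<le> N" "x = p j" by (auto simp: S_def)
      then show False
        using partition_mono[of N p, OF p(3), of j i] partition_mono[of N p, OF p(3), of "Suc i" j] i that
        by (cases "j \<le> i") (auto simp: T_def)
    qed
    from pieces[OF i] obtain g where g: "Ck_on (m + 2) g {p i..p (Suc i)}" "\<forall>x\<in>T. u x = g x"
      by (auto simp: T_def)
    obtain G where G: "\<And>x. x \<in> {p i..p (Suc i)} \<Longrightarrow> G 0 x = g x"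
      "\<And>j. j \<le> m + 2 \<Longrightarrow> continuous_on {p i..p (Suc i)} (G j)"
      "\<And>j x. j < m + 2 \<Longrightarrow> x \<in> {p i<..<p (Suc i)} \<Longrightarrow> (G j has_real_derivative G (Suc j) x) (at x)"
      by (rule Ck_onE[OF g(1)]) blast
    have eq: "D0 m x = G m x" if "x \<in> T" for x
    proof (rule derivatives_agree_on_open[of T D0 G m])
      show "D0 0 y = G 0 y" if y: "y \<in> T" for y
      proof -
        have "y \<in> {\<alpha>..\<beta>}" "y \<in> {p i..p (Suc i)}" using y sub by (auto simp: T_def)
        then show ?thesis using D0(1) G(1) g(2) y by simp
      qed
    qed (use D0(3) G(3) sub that in \<open>auto simp: T_def\<close>)
    have der: "(D0 m has_real_derivative G (Suc m) x) (at x)" if x: "x \<in> T" for x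
    proof (rule has_field_derivative_transform_within_open)
      show "(G m has_real_derivative G (Suc m) x) (at x)" using G(3)[of m x] x by (simp add: T_def)
      show "open T" by (simp add: T_def)
    qed (use x eq in auto)
    have V: "V x = G (Suc m) x" if "x \<in> T" for x
      using DERIV_imp_deriv[OF der[OF that]] TS[OF that] by (simp add: V_def)
    show ?thesis
      using V der G(2)[of "Suc m"] G(2)[of "Suc (Suc m)"] G(3)[of "Suc m"]
      unfolding T_def[symmetric] by (intro exI[of _ G]) auto
  qed
  have "\<exists>P Q. mono_on {p 0..p N} P \<and> mono_on {p 0..p N} Q \<and> (\<forall>x\<in>{p 0..p N}. V x = P x - Q x)"
    by (rule piecewise_C1_monotone_difference[of N p, OF p(3)]) (use piece in blast)+
  then obtain P Q where PQ: "mono_on {\<alpha>..\<beta>} P" "mono_on {\<alpha>..\<beta>} Q" "\<And>x. x \<in> {\<alpha>..\<beta>} \<Longrightarrow> V x = P x - Q x"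
    by (auto simp: p)
  have Dder: "(D j has_real_derivative D (Suc j) x) (at x)" if "j \<le> m" "x \<in> {\<alpha><..<\<beta>} - S" for j x
  proof (cases "j = m")
    case True
    have "\<exists>i<N. x \<in> {p i<..<p (Suc i)}"
      by (rule partition_cover) (use that p in \<open>auto simp: S_def\<close>)
    then obtain i where i: "i < N" "x \<in> {p i<..<p (Suc i)}" by blast
    with piece[OF i(1)] have "(D0 m has_real_derivative V x) (at x)" by blast
    then show ?thesis using True by (simp add: D_def)
  next
    case False
    then show ?thesis using D0(3)[of j x] that by (simp add: D_def)
  qed
  show ?thesis
  proof (rule that[of S D P Q])
    show "finite S" by (simp add: S_def)
  qed (use D0 PQ Dder in \<open>auto simp: D_def\<close>)
qed

section \<open>The error on short intervals\<close>

lemma integral_eq_rescale: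
  fixes v :: "real \<Rightarrow> real"
  assumes ab: "a < b" and v: "continuous_on {a..b} v"
  shows "integral {a..b} v = (b - a) / 2 * integral {-1..1} (rescale a b v)"
proof -
  have "(v has_integral integral {a..b} v) (cbox a b)"
    using integrable_continuous_real[OF v] by (simp add: integrable_integral)
  moreover have "(a - (a + b) / 2) /\<^sub>R ((b - a) / 2) = -1" "(b - (a + b) / 2) /\<^sub>R ((b - a) / 2) = 1"
    using ab by (simp_all add: field_simps)
  ultimately have "((\<lambda>x. v ((b - a) / 2 * x + (a + b) / 2)) has_integral
      inverse ((b - a) / 2) * integral {a..b} v) {-1..1}"
    using has_integral_affinity'[of v "integral {a..b} v" a b "(b - a) / 2" "(a + b) / 2"] ab
    by (simp only: DIM_real power_one_right interval_cbox real_scaleR_def) simp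
  then have "integral {-1..1} (rescale a b v) = inverse ((b - a) / 2) * integral {a..b} v"
    unfolding rescale_def by (rule integral_unique)
  then show ?thesis using ab by simp
qed

text \<open>The common core of both error bounds: \<open>D (Suc r)\<close> is the highest available derivative and \<open>e\<close>
  the order of decay of its own coefficients.

  If the degree of exactness is large, all \<open>r + 1\<close> derivatives are used, which gives the full order
  in \<open>h\<close> and in \<open>1 / n\<close>. Otherwise only \<open>d\<close> derivatives may be used, \<open>d - 1\<close> being the degree of exactness,
  because the coefficients with index from \<open>d\<close> on all contribute and \<open>d\<close> integrations by parts
  require the index to be at least \<open>d\<close>. This yields the order \<open>d + 1\<close> in \<open>h\<close>. It occurs for \<open>n < q\<close>
  only, so that the missing powers of \<open>1 / n\<close> are absorbed in the constant.\<close>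
lemma fejer_rule_error_le:
  fixes D :: "nat \<Rightarrow> real \<Rightarrow> real" and u :: "real \<Rightarrow> real"
  assumes S: "finite S" and u: "\<And>x. x \<in> {\<alpha>..\<beta>} \<Longrightarrow> D 0 x = u x"
    and cont: "\<And>j. j \<le> r \<Longrightarrow> continuous_on {\<alpha>..\<beta>} (D j)"
    and der: "\<And>j x. j \<le> r \<Longrightarrow> x \<in> {\<alpha><..<\<beta>} - S \<Longrightarrow> (D j has_real_derivative D (Suc j) x) (at x)"
    and int: "\<And>a b k. \<alpha> \<le> a \<Longrightarrow> a < b \<Longrightarrow> b \<le> \<beta> \<Longrightarrow>
       (\<lambda>x. rescale a b (D (Suc r)) (cos x) * cos (real k * x)) integrable_on {0..pi}"
    and bnd: "\<And>x. x \<in> {\<alpha>..\<beta>} \<Longrightarrow> \<bar>D (Suc r) x\<bar> \<le> B"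
    and decay: "\<And>a b k. \<alpha> \<le> a \<Longrightarrow> a < b \<Longrightarrow> b \<le> \<beta> \<Longrightarrow> k \<ge> e \<Longrightarrow>
       \<bar>cheb_coeff (rescale a b (D (Suc r))) k\<bar> \<le> A / (\<Prod>j<e. real k - real j)"
    and A: "A \<ge> 0" and e: "e \<le> 1" and q: "q = Suc r + e" "q \<ge> 2"
  shows "\<exists>C>0. \<forall>a b. \<forall>n\<ge>1. {a..b} \<subseteq> {\<alpha>..\<beta>} \<and> 0 < b - a \<and> b - a \<le> 1 \<longrightarrow>
               \<bar>integral {a..b} u - fejer_quadrature (b - a) n (rescale a b u)\<bar>
                 \<le> C * ((b - a) ^ min (n + 1 + (if odd n then 1 else 0)) (r + 2) / real n ^ q)"
proof -
  have "\<exists>M. \<forall>x\<in>{\<alpha>..\<beta>}. \<bar>D j x\<bar> \<le> M" if "j \<le> Suc r" for j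
  proof (cases "j = Suc r")
    case True
    then show ?thesis using bnd by blast
  next
    case False
    then have "bounded (D j ` {\<alpha>..\<beta>})"
      using cont[of j] that by (intro compact_imp_bounded compact_continuous_image) auto
    then show ?thesis by (auto simp: bounded_iff)
  qed
  then obtain M where M: "\<And>j x. j \<le> Suc r \<Longrightarrow> x \<in> {\<alpha>..\<beta>} \<Longrightarrow> \<bar>D j x\<bar> \<le> M j" by metis
  define M' where "M' = (\<Sum>j\<le>Suc r. \<bar>M j\<bar>)"
  have M': "\<bar>D j x\<bar> \<le> M'" if "j \<le> Suc r" "x \<in> {\<alpha>..\<beta>}" for j x
    using M[OF that] member_le_sum[of j "{..Suc r}" "\<lambda>j. \<bar>M j\<bar>"] that by (auto simp: M'_def)
  have M'0: "M' \<ge> 0" unfolding M'_def by (intro sum_nonneg) auto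
  define Q where "Q = real q ^ q"
  have Q1: "Q \<ge> 1" unfolding Q_def using q by (intro one_le_power) auto
  define C where "C = 12 * A * Q + 12 * (pi * M') * Q * Q + 1"
  have C: "C > 0" using A M'0 Q1 by (auto simp: C_def intro!: add_nonneg_pos mult_nonneg_nonneg)
  show ?thesis
  proof (intro exI[of _ C] conjI C allI impI)
    fix a b :: real and n :: nat
    assume n: "1 \<le> n" and "{a..b} \<subseteq> {\<alpha>..\<beta>} \<and> 0 < b - a \<and> b - a \<le> 1"
    then have ab: "a < b" and sub: "\<alpha> \<le> a" "b \<le> \<beta>" and h1: "b - a \<le> 1" by auto
    define h where "h = b - a"
    have h: "0 < h" "h \<le> 1" using ab h1 by (auto simp: h_def)
    define d where "d = n + (if odd n then 1 else 0)"
    define v where "v = rescale a b u"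
    have cab: "continuous_on {a..b} (D j)" if "j \<le> r" for j
      using continuous_on_subset[OF cont[OF that]] sub by auto
    have dab: "(D j has_real_derivative D (Suc j) x) (at x)" if "j \<le> r" "x \<in> {a<..<b} - S" for j x
      using der[of j x] that sub by auto
    have uab: "u x = D 0 x" if "x \<in> {a..b}" for x using u[of x] that sub by simp
    have cu: "continuous_on {a..b} u"
      using cab[of 0] continuous_on_cong[OF refl uab, of "{a..b}" "\<lambda>x. x"] by simp
    have coeff_u: "cheb_coeff v k = cheb_coeff (rescale a b (D 0)) k" for k
      unfolding cheb_coeff_def v_def rescale_def
      by (intro integral_cong) (simp only: uab[OF rescale_cos_mem[OF ab]])
    have cv: "continuous_on {-1..1} v"
    proof -
      have "(b - a) / 2 * t + (a + b) / 2 \<in> {a..b}" if "t \<in> {-1..1}" for t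
        using rescale_cos_mem[OF ab, of "arccos t"] that by simp
      then show ?thesis unfolding v_def rescale_def
        by (intro continuous_on_compose2[OF cu] continuous_intros) auto
    qed
    define err where "err = integral {a..b} u - fejer_quadrature (b - a) n (rescale a b u)"
    have err: "\<bar>err\<bar> = h / 2 * \<bar>integral {-1..1} v - integral {-1..1} (poly (fejer_interpolant n v))\<bar>"
      unfolding err_def integral_eq_rescale[OF ab cu] fejer_quadrature_def v_def h_def right_diff_distrib[symmetric] abs_mult
      using ab by simp
    have gen: "\<bar>err\<bar> \<le> 12 * h ^ Suc i * X / real n ^ p"
      if X: "X \<ge> 0" and p: "p \<ge> 2" and dec: "\<And>k. k \<ge> d \<Longrightarrow> \<bar>cheb_coeff v k\<bar> \<le> h ^ i * X / real k ^ p" for i p X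
    proof -
      have "\<bar>integral {-1..1} v - integral {-1..1} (poly (fejer_interpolant n v))\<bar> \<le> 24 * (h ^ i * X) / real n ^ p"
        by (rule fejer_error_le_coeff_decay[OF n cv p]) (use dec X h in \<open>auto simp: d_def\<close>)
      then have "\<bar>err\<bar> \<le> h / 2 * (24 * (h ^ i * X) / real n ^ p)"
        unfolding err using h by (intro mult_left_mono) auto
      then show ?thesis by (simp add: mult_ac)
    qed
    have "\<bar>err\<bar> \<le> C * (h ^ min (d + 1) (r + 2) / real n ^ q)"
    proof (cases "d \<ge> q")
      case True
      have "\<bar>err\<bar> \<le> 12 * h ^ Suc (Suc r) * (A * Q) / real n ^ q"
      proof (rule gen)
        fix k assume k: "k \<ge> d"
        show "\<bar>cheb_coeff v k\<bar> \<le> h ^ Suc r * (A * Q) / real k ^ q"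
          unfolding coeff_u h_def Q_def q(1)
          by (rule cheb_coeff_power_decay[OF ab S A])
             (use cab dab int decay sub ab k True q in auto)
      qed (use A Q1 q in auto)
      also have "\<dots> = (12 * A * Q) * (h ^ (r + 2) / real n ^ q)" by simp
      also have "\<dots> \<le> C * (h ^ (r + 2) / real n ^ q)"
        using h M'0 Q1 by (intro mult_right_mono) (auto simp: C_def)
      also have "r + 2 = min (d + 1) (r + 2)" using True q by simp
      finally show ?thesis .
    next
      case False
      \<comment> \<open>\<open>d\<close> is even and positive, hence at least 2, as needed for a convergent series.\<close>
      have d: "d \<ge> 2" "d \<le> Suc r" "n \<le> d"
        using n False q e by (auto simp: d_def elim: oddE)
      have intd: "(\<lambda>x. rescale a b (D d) (cos x) * cos (real k * x)) integrable_on {0..pi}" for k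
      proof (cases "d = Suc r")
        case True
        then show ?thesis using int[OF sub(1) ab sub(2)] by simp
      next
        case False
        then show ?thesis using d
          by (intro integrable_continuous_real continuous_intros continuous_on_rescale_cos[OF ab] cab) auto
      qed
      have "\<bar>err\<bar> \<le> 12 * h ^ Suc d * (pi * M' * real d ^ d) / real n ^ d"
      proof (rule gen)
        fix k assume k: "k \<ge> d"
        have "\<bar>cheb_coeff (rescale a b (D 0)) k\<bar> \<le> (b - a) ^ d * (pi * M' * real (d + 0) ^ (d + 0)) / real k ^ (d + 0)"
        proof (rule cheb_coeff_power_decay[OF ab S])
          fix k :: nat
          have "\<bar>rescale a b (D d) t\<bar> \<le> M'" if "t \<in> {-1..1}" for t
            using rescale_cos_mem[OF ab, of "arccos t"] that sub d unfolding rescale_def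
            by (intro M') auto
          then have "\<bar>cheb_coeff (rescale a b (D d)) k\<bar> \<le> pi * M'"
            by (rule cheb_coeff_bounded[OF intd])
          then show "\<bar>cheb_coeff (rescale a b (D d)) k\<bar> \<le> pi * M' / (\<Prod>j<0. real k - real j)" by simp
        qed (use cab dab intd M'0 k d in auto)
        then show "\<bar>cheb_coeff v k\<bar> \<le> h ^ d * (pi * M' * real d ^ d) / real k ^ d"
          by (simp add: coeff_u h_def)
      qed (use M'0 d in auto)
      also have "\<dots> = 12 * h ^ Suc d * (pi * M') * (real d ^ d * (1 / real n ^ d))" by simp
      also have "\<dots> \<le> 12 * h ^ Suc d * (pi * M') * (Q * (Q / real n ^ q))"
      proof (intro mult_left_mono mult_mono)
        have le: "x ^ i \<le> Q" if "0 \<le> x" "x \<le> real q" "i \<le> q" for x :: real and i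
        proof -
          have "x ^ i \<le> real q ^ i" using that by (intro power_mono) auto
          also have "\<dots> \<le> Q" unfolding Q_def using that q by (intro power_increasing) auto
          finally show ?thesis .
        qed
        show "real d ^ d \<le> Q" using False by (intro le) auto
        \<comment> \<open>The missing powers of \<open>1 / n\<close>.\<close>
        have "real n ^ q = real n ^ (q - d) * real n ^ d"
          using False by (simp flip: power_add)
        moreover have "real n ^ (q - d) \<le> Q" using False d by (intro le) auto
        ultimately show "1 / real n ^ d \<le> Q / real n ^ q"
          using n by (simp add: divide_simps)
      qed (use h M'0 Q1 in auto)
      also have "\<dots> = (12 * (pi * M') * Q * Q) * (h ^ (d + 1) / real n ^ q)" by simp
      also have "\<dots> \<le> C * (h ^ (d + 1) / real n ^ q)"
        using h A Q1 by (intro mult_right_mono) (auto simp: C_def)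
      also have "d + 1 = min (d + 1) (r + 2)" using d by simp
      finally show ?thesis .
    qed
    then show "\<bar>integral {a..b} u - fejer_quadrature (b - a) n (rescale a b u)\<bar>
       \<le> C * ((b - a) ^ min (n + 1 + (if odd n then 1 else 0)) (r + 2) / real n ^ q)"
      by (simp add: err_def d_def h_def)
  qed
qed

text \<open>The highest derivative, of order \<open>m + 1\<close>, is a difference of monotone functions, so its coefficients
  decay like \<open>1 / k\<close>: there is one order in \<open>1 / n\<close> more than derivatives, which explains why the
  exponents of \<open>h\<close> (with one power from the length of the interval) and of \<open>1 / n\<close> agree.\<close>
lemma fejer_rule_X_space:
  assumes u: "u \<in> X_space m \<alpha> \<beta>"
  shows "\<exists>C>0. \<forall>a b. \<forall>n\<ge>1. {a..b} \<subseteq> {\<alpha>..\<beta>} \<and> 0 < b - a \<and> b - a \<le> 1 \<longrightarrow>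
               \<bar>integral {a..b} u - fejer_quadrature (b - a) n (rescale a b u)\<bar>
                 \<le> C * ((b - a) ^ min (n + 1 + (if odd n then 1 else 0)) (m + 2) / real n ^ (m + 2))"
proof -
  obtain D S P Q where *: "finite S" "\<And>x. x \<in> {\<alpha>..\<beta>} \<Longrightarrow> D 0 x = u x"
    "\<And>j. j \<le> m \<Longrightarrow> continuous_on {\<alpha>..\<beta>} (D j)"
    "\<And>j x. j \<le> m \<Longrightarrow> x \<in> {\<alpha><..<\<beta>} - S \<Longrightarrow> (D j has_real_derivative D (Suc j) x) (at x)"
    and PQ: "mono_on {\<alpha>..\<beta>} P" "mono_on {\<alpha>..\<beta>} Q" "\<And>x. x \<in> {\<alpha>..\<beta>} \<Longrightarrow> D (Suc m) x = P x - Q x"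
    by (rule X_spaceE[OF u]) blast
  define B where "B = \<bar>P \<alpha>\<bar> + \<bar>P \<beta>\<bar> + \<bar>Q \<alpha>\<bar> + \<bar>Q \<beta>\<bar>"
  have PB: "\<bar>P x\<bar> + \<bar>Q x\<bar> \<le> B" if x: "x \<in> {\<alpha>..\<beta>}" for x
  proof -
    have "P \<alpha> \<le> P x" "P x \<le> P \<beta>" "Q \<alpha> \<le> Q x" "Q x \<le> Q \<beta>"
      using x by (auto intro!: mono_onD[OF PQ(1)] mono_onD[OF PQ(2)])
    then show ?thesis by (auto simp: B_def)
  qed
  have eq: "rescale a b (D (Suc m)) (cos x) * cos (real k * x) =
      rescale a b P (cos x) * cos (real k * x) - rescale a b Q (cos x) * cos (real k * x)"
    if "\<alpha> \<le> a" "a < b" "b \<le> \<beta>" for a b x k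
    using PQ(3)[of "(b - a) / 2 * cos x + (a + b) / 2"] rescale_cos_mem[OF that(2), of x] that
    by (simp add: rescale_def left_diff_distrib)
  have mono: "mono_on {a..b} P" "mono_on {a..b} Q" if "\<alpha> \<le> a" "b \<le> \<beta>" for a b
    using PQ that by (auto intro: mono_on_subset)
  show ?thesis
  proof (rule fejer_rule_error_le[where S = S and D = D and r = m and e = 1 and A = "4 * B" and B = B])
    fix a b k assume ab: "\<alpha> \<le> a" "a < b" "b \<le> \<beta>"
    note int = cheb_coeff_mono(1)[OF ab(2) mono(1)[OF ab(1,3)]] cheb_coeff_mono(1)[OF ab(2) mono(2)[OF ab(1,3)]]
    show "(\<lambda>x. rescale a b (D (Suc m)) (cos x) * cos (real k * x)) integrable_on {0..pi}"
      unfolding eq[OF ab] by (intro integrable_diff int)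
    assume k: "1 \<le> k"
    have "cheb_coeff (rescale a b (D (Suc m))) k = cheb_coeff (rescale a b P) k - cheb_coeff (rescale a b Q) k"
      unfolding cheb_coeff_def eq[OF ab] by (intro integral_diff int)
    also have "\<bar>\<dots>\<bar> \<le> \<bar>cheb_coeff (rescale a b P) k\<bar> + \<bar>cheb_coeff (rescale a b Q) k\<bar>" by simp
    also have "\<dots> \<le> 2 * (\<bar>P a\<bar> + \<bar>P b\<bar>) / real k + 2 * (\<bar>Q a\<bar> + \<bar>Q b\<bar>) / real k"
      by (intro add_mono cheb_coeff_mono(2) mono ab k)
    also have "\<dots> = 2 * ((\<bar>P a\<bar> + \<bar>Q a\<bar>) + (\<bar>P b\<bar> + \<bar>Q b\<bar>)) / real k"
      by (simp add: add_divide_distrib algebra_simps)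
    also have "\<dots> \<le> 2 * (B + B) / real k"
      using ab by (intro divide_right_mono mult_left_mono add_mono PB) auto
    finally show "\<bar>cheb_coeff (rescale a b (D (Suc m))) k\<bar> \<le> 4 * B / (\<Prod>j<1. real k - real j)"
      by simp
  next
    fix x assume "x \<in> {\<alpha>..\<beta>}"
    then show "\<bar>D (Suc m) x\<bar> \<le> B" using PB[of x] PQ(3)[of x] by auto
  qed (use * in \<open>auto simp: B_def\<close>)
qed

text \<open>Here \<open>m + 2\<close> bounded derivatives give the order \<open>m + 2\<close> in \<open>1 / n\<close> directly, and each of them
  contributes a power of \<open>h\<close> in addition to the one from the length of the interval.\<close>
lemma fejer_rule_Ck:
  assumes u: "Ck_on (m + 2) u {\<alpha>..\<beta>}"
  shows "\<exists>C>0. \<forall>a b. \<forall>n\<ge>1. {a..b} \<subseteq> {\<alpha>..\<beta>} \<and> 0 < b - a \<and> b - a \<le> 1 \<longrightarrow>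
               \<bar>integral {a..b} u - fejer_quadrature (b - a) n (rescale a b u)\<bar>
                 \<le> C * ((b - a) ^ min (n + 1 + (if odd n then 1 else 0)) (m + 3) / real n ^ (m + 2))"
proof -
  obtain D where D: "\<And>x. x \<in> {\<alpha>..\<beta>} \<Longrightarrow> D 0 x = u x"
    "\<And>j. j \<le> m + 2 \<Longrightarrow> continuous_on {\<alpha>..\<beta>} (D j)"
    "\<And>j x. j < m + 2 \<Longrightarrow> x \<in> {\<alpha><..<\<beta>} \<Longrightarrow> (D j has_real_derivative D (Suc j) x) (at x)"
    by (rule Ck_onE[OF u]) blast
  have "bounded (D (m + 2) ` {\<alpha>..\<beta>})"
    using D(2)[of "m + 2"] by (intro compact_imp_bounded compact_continuous_image) auto
  then obtain B0 where "\<forall>y\<in>D (m + 2) ` {\<alpha>..\<beta>}. norm y \<le> B0"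
    unfolding bounded_iff by blast
  then have B0: "\<bar>D (m + 2) x\<bar> \<le> B0" if "x \<in> {\<alpha>..\<beta>}" for x
    using that by auto
  define B where "B = \<bar>B0\<bar>"
  have B: "\<bar>D (m + 2) x\<bar> \<le> B" if "x \<in> {\<alpha>..\<beta>}" for x using B0[OF that] by (simp add: B_def)
  have "\<exists>C>0. \<forall>a b. \<forall>n\<ge>1. {a..b} \<subseteq> {\<alpha>..\<beta>} \<and> 0 < b - a \<and> b - a \<le> 1 \<longrightarrow>
               \<bar>integral {a..b} u - fejer_quadrature (b - a) n (rescale a b u)\<bar>
                 \<le> C * ((b - a) ^ min (n + 1 + (if odd n then 1 else 0)) (m + 1 + 2) / real n ^ (m + 2))"
  proof (rule fejer_rule_error_le[where S = "{}" and D = D and e = 0 and A = "pi * B" and B = B])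
    fix a b k assume ab: "\<alpha> \<le> a" "a < b" "b \<le> \<beta>"
    have "continuous_on {a..b} (D (Suc (m + 1)))"
      by (rule continuous_on_subset[OF D(2)]) (use ab in auto)
    then show int: "(\<lambda>x. rescale a b (D (Suc (m + 1))) (cos x) * cos (real k * x)) integrable_on {0..pi}"
      by (intro integrable_continuous_real continuous_intros continuous_on_rescale_cos[OF ab(2)])
    have "\<bar>rescale a b (D (Suc (m + 1))) t\<bar> \<le> B" if "t \<in> {-1..1}" for t
      using rescale_cos_mem[OF ab(2), of "arccos t"] that ab B[of "(b - a) / 2 * t + (a + b) / 2"]
      unfolding rescale_def by simp
    then have "\<bar>cheb_coeff (rescale a b (D (Suc (m + 1)))) k\<bar> \<le> pi * B"
      by (rule cheb_coeff_bounded[OF int])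
    then show "\<bar>cheb_coeff (rescale a b (D (Suc (m + 1)))) k\<bar> \<le> pi * B / (\<Prod>j<0. real k - real j)" by simp
  qed (use D B in \<open>auto simp: B_def\<close>)
  then show ?thesis by (simp add: numeral_3_eq_3)
qed

theorem theorem3p8:
  fixes m :: nat and \<alpha> \<beta> :: real and u :: "real \<Rightarrow> real" and n\<^sub>0 :: "nat \<Rightarrow> nat"
  assumes "\<alpha> \<le> \<beta>"
    and n0: "\<And>n. n\<^sub>0 n = (if odd n then 1 else 0)"
  shows "(u \<in> X_space m \<alpha> \<beta> \<longrightarrow>
            (\<exists>C>0. \<forall>a b. \<forall>n\<ge>1. {a..b} \<subseteq> {\<alpha>..\<beta>} \<and> 0 < b - a \<and> b - a \<le> 1 \<longrightarrow>
               \<bar>integral {a..b} u - fejer_quadrature (b - a) n (rescale a b u)\<bar>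
                 \<le> C * ((b - a) ^ min (n + 1 + n\<^sub>0 n) (m + 2) / real n ^ (m + 2)))) \<and>
         (Ck_on (m + 2) u {\<alpha>..\<beta>} \<longrightarrow>
            (\<exists>C>0. \<forall>a b. \<forall>n\<ge>1. {a..b} \<subseteq> {\<alpha>..\<beta>} \<and> 0 < b - a \<and> b - a \<le> 1 \<longrightarrow>
               \<bar>integral {a..b} u - fejer_quadrature (b - a) n (rescale a b u)\<bar>
                 \<le> C * ((b - a) ^ min (n + 1 + n\<^sub>0 n) (m + 3) / real n ^ (m + 2))))"
  unfolding n0 using fejer_rule_X_space fejer_rule_Ck by blast

end
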